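(* Let $p\ge 11$ be a prime number. Then every finite Abelian $p$-group $G$ has difference characteristic $$\eth[G]\le \frac{\sqrt{p}-1}{\sqrt{p}-3}\cdot\sup_{k\in\mathbb{N}}\eth[C_{p^k}]\le \frac{\sqrt{p}-1}{\sqrt{p}-3}\cdot\frac{24}{\sqrt{293}}.$$
   Context: For a subset $A$ of a group $G$, a subset $B\subseteq G$ is a difference basis for $A$ if every $a\in A$ can be written as $a=xy^{-1}$ with $x,y\in B$. The difference size $\Delta[A]$ is the smallest cardinality of a difference basis for $A$, and for finite nonempty $A$ the difference characteristic is $\eth[A]=\Delta[A]/\sqrt{|A|}$. $C_n$ denotes the cyclic group of order $n$. *)

theory Defs
  imports
    "HOL-Algebra.Elementary_Groups"
    "HOL-Algebra.Multiplicative_Group"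
    "HOL-Computational_Algebra.Primes"
    "HOL-Library.Extended_Real"
begin

definition difference_basis :: "('a, 'b) monoid_scheme \<Rightarrow> 'a set \<Rightarrow> 'a set \<Rightarrow> bool" where
  "difference_basis G A B \<longleftrightarrow>
     B \<subseteq> carrier G \<and> (\<forall>a\<in>A. \<exists>x\<in>B. \<exists>y\<in>B. a = x \<otimes>\<^bsub>G\<^esub> inv\<^bsub>G\<^esub> y)"

text \<open>
  The bases are required to be finite because \<open>card\<close> of an infinite set is 0.
  For finite \<open>A\<close> a finite basis always exists (\<open>A\<close> together with the identity), so the
  minimum is attained; for infinite \<open>A\<close> the value is unspecified.
\<close>
definition difference_size :: "('a, 'b) monoid_scheme \<Rightarrow> 'a set \<Rightarrow> nat" where
  "difference_size G A = (LEAST n. \<exists>B. finite B \<and> difference_basis G A B \<and> card B = n)"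

definition difference_char :: "('a, 'b) monoid_scheme \<Rightarrow> 'a set \<Rightarrow> real" where
  "difference_char G A = real (difference_size G A) / sqrt (real (card A))"

text \<open>Elements of infinite order have \<open>ord\<close> equal to 0, hence do not occur in a \<open>p\<close>-group.\<close>
definition p_group :: "nat \<Rightarrow> ('a, 'b) monoid_scheme \<Rightarrow> bool" where
  "p_group p G \<longleftrightarrow> group G \<and> (\<forall>x\<in>carrier G. \<exists>k. group.ord G x = p ^ k)"

abbreviation cyclic_difference_char :: "nat \<Rightarrow> real" where
  "cyclic_difference_char n \<equiv>
     difference_char (integer_mod_group n) (carrier (integer_mod_group n))"

end

theory Submission
  imports Defs
begin

text \<open>
  A finite Abelian \<open>p\<close>-group \<open>K\<close> contains a subgroup \<open>H\<close> isomorphic to \<open>R \<times> R\<close> with \<open>K/H\<close> cyclic,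
  where \<open>R\<close> is the additive group of a local ring with residue field of \<open>p\<close> elements. The graph of
  squaring in \<open>R \<times> R\<close> is a set of size \<open>\<bar>R\<bar>\<close> whose differences cover everything outside a subgroup of
  index at least \<open>p\<close>, so induction on the order bounds the difference characteristic of \<open>H\<close> by
  \<open>1 + SF/\<surd>p \<le> F\<close>, where \<open>F = (\<surd>p - 1)/(\<surd>p - 3)\<close> and \<open>S \<le> 2\<close> is the supremum over cyclic groups.
  Since difference characteristics are submultiplicative in extensions, \<open>K\<close> then has difference
  characteristic at most \<open>S F\<close>. No Galois rings are needed: the trivial extension \<open>\<int>/q \<oplus> L\<close> with
  \<open>L\<cdot>L = 0\<close> serves as \<open>R\<close>. The bound on \<open>S\<close> comes from Wichmann's sparse rulers, whose number of
  marks is about \<open>\<surd>(3/2)\<close> times the square root of the number of residues they cover.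
\<close>

section \<open>Sparse rulers\<close>

text \<open>
  Wichmann's sparse ruler: its consecutive gaps are \<open>r\<close> times \<open>1\<close>, once \<open>r+1\<close>, \<open>r\<close> times \<open>2r+1\<close>,
  \<open>s\<close> times \<open>4r+3\<close>, \<open>r+1\<close> times \<open>2r+2\<close>, \<open>r\<close> times \<open>1\<close>.
\<close>

definition wichmann :: "int \<Rightarrow> int \<Rightarrow> int set" where
  "wichmann r s =
     {0..r} \<union> (\<lambda>j. (2*r+1) * j) ` {1..r+1}
     \<union> (\<lambda>t. (2*r+1) * (r+1) + (4*r+3) * t) ` {1..s}
     \<union> (\<lambda>j. (2*r+1) * (r+1) + (4*r+3) * s + (2*r+2) * j) ` {1..r+1}
     \<union> (\<lambda>i. (2*r+1) * (r+1) + (4*r+3) * s + (2*r+2) * (r+1) + i) ` {1..r}"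

lemma finite_wichmann: "finite (wichmann r s)"
  by (simp add: wichmann_def)

lemma card_wichmann_le:
  assumes "0 \<le> r" "0 \<le> s"
  shows "int (card (wichmann r s)) \<le> 4*r + s + 3"
proof -
  have c: "int (card (f ` {1..m})) \<le> m" if "0 \<le> m" for f :: "int \<Rightarrow> int" and m :: int
    using card_image_le[of "{1..m}" f] that by simp
  have u: "int (card (A \<union> B)) \<le> a + b" if "int (card A) \<le> a" "int (card B) \<le> b"
    for A B :: "int set" and a b
    using card_Un_le[of A B] that by linarith
  have "int (card (wichmann r s)) \<le> (r+1) + (r+1) + s + (r+1) + r"
    unfolding wichmann_def using assms by (intro u c) auto
  then show ?thesis by simp
qed

text \<open>The definition lists the mark shared by two consecutive blocks only once, which keeps
  the count low. Here every block is closed up at its left end, so that a distance can start or end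
  at a shared mark without a case split.\<close>

lemma wichmann_marks:
  assumes "0 \<le> r" "0 \<le> s"
  shows "\<And>i. 0 \<le> i \<Longrightarrow> i \<le> r \<Longrightarrow> i \<in> wichmann r s"
    and "\<And>j. 0 \<le> j \<Longrightarrow> j \<le> r+1 \<Longrightarrow> (2*r+1) * j \<in> wichmann r s"
    and "\<And>t. 0 \<le> t \<Longrightarrow> t \<le> s \<Longrightarrow> (2*r+1) * (r+1) + (4*r+3) * t \<in> wichmann r s"
    and "\<And>j. 0 \<le> j \<Longrightarrow> j \<le> r+1 \<Longrightarrow>
      (2*r+1) * (r+1) + (4*r+3) * s + (2*r+2) * j \<in> wichmann r s"
    and "\<And>i. 0 \<le> i \<Longrightarrow> i \<le> r \<Longrightarrow>
      (2*r+1) * (r+1) + (4*r+3) * s + (2*r+2) * (r+1) + i \<in> wichmann r s"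
proof -
  show 1: "i \<in> wichmann r s" if "0 \<le> i" "i \<le> r" for i
    using that by (simp add: wichmann_def)
  show 2: "(2*r+1) * j \<in> wichmann r s" if "0 \<le> j" "j \<le> r+1" for j
  proof (cases "j = 0")
    case True then show ?thesis using 1[of 0] assms by simp
  next
    case False
    then have "j \<in> {1..r+1}" using that by simp
    then show ?thesis unfolding wichmann_def by blast
  qed
  show 3: "(2*r+1) * (r+1) + (4*r+3) * t \<in> wichmann r s" if "0 \<le> t" "t \<le> s" for t
  proof (cases "t = 0")
    case True then show ?thesis using 2[of "r+1"] assms by simp
  next
    case False
    then have "t \<in> {1..s}" using that by simp
    then show ?thesis unfolding wichmann_def by blast
  qed
  show 4: "(2*r+1) * (r+1) + (4*r+3) * s + (2*r+2) * j \<in> wichmann r s"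
    if "0 \<le> j" "j \<le> r+1" for j
  proof (cases "j = 0")
    case True then show ?thesis using 3[of s] assms by simp
  next
    case False
    then have "j \<in> {1..r+1}" using that by simp
    then show ?thesis unfolding wichmann_def by blast
  qed
  show "(2*r+1) * (r+1) + (4*r+3) * s + (2*r+2) * (r+1) + i \<in> wichmann r s"
    if "0 \<le> i" "i \<le> r" for i
  proof (cases "i = 0")
    case True then show ?thesis using 4[of "r+1"] assms by simp
  next
    case False
    then have "i \<in> {1..r}" using that by simp
    then show ?thesis unfolding wichmann_def by blast
  qed
qed

section \<open>Completeness of Wichmann's rulers\<close>

definition wdiff :: "int \<Rightarrow> int \<Rightarrow> int \<Rightarrow> bool" where
  "wdiff r s d \<longleftrightarrow> (\<exists>x\<in>wichmann r s. \<exists>y\<in>wichmann r s. d = x - y)"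

lemma wdiffI: "x \<in> wichmann r s \<Longrightarrow> y \<in> wichmann r s \<Longrightarrow> d = x - y \<Longrightarrow> wdiff r s d"
  by (auto simp: wdiff_def)

context
  fixes r s :: int
  assumes r: "0 \<le> r" and s: "0 \<le> s"
begin

lemmas marks = wichmann_marks[OF r s]

text \<open>
  Distances are written as \<open>(2r+1)a + x\<close>. The long gaps \<open>2r+1\<close>, \<open>2r+2\<close> and \<open>4r+3 = 2(2r+1)+1\<close>
  contribute \<open>1\<close>, \<open>1\<close>, \<open>2\<close> to the row \<open>a\<close> and \<open>0\<close>, \<open>1\<close>, \<open>1\<close> to the offset \<open>x\<close>. In each row the
  attained offsets form an interval, and the intervals of consecutive rows leave no gap.
\<close>

lemma wdiff_low:
  assumes "0 \<le> j" "j \<le> r+1" "0 \<le> i" "i \<le> r"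
  shows "wdiff r s ((2*r+1) * j - i)" and "wdiff r s ((2*r+1) * j + (j + i))"
proof -
  show "wdiff r s ((2*r+1) * j - i)"
    by (rule wdiffI[OF marks(2)[of j] marks(1)[of i]]) (use assms in auto)
  show "wdiff r s ((2*r+1) * j + (j + i))"
    by (rule wdiffI[OF marks(5)[of i] marks(4)[of "r+1-j"]]) (use assms in \<open>auto simp: algebra_simps\<close>)
qed

text \<open>Only runs of long gaps are used. With k, l, n gaps of lengths 2r+1, 4r+3, 2r+2 one has a
  = k + 2l + n and x = l + n, so k - n = a - 2x. Such a run uses all s middle gaps, or no gap 2r+2,
  or no gap 2r+1; these are the three cases, and each determines k, l, n.\<close>

lemma wdiff_core:
  assumes "0 \<le> x" "x \<le> a" "\<bar>a - 2*x\<bar> \<le> r+1" "a \<le> 2*s + r + 2"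
  shows "wdiff r s ((2*r+1) * a + x)"
proof -
  consider "s < x" "s < a - x" | "x \<le> s" "2*x \<le> a" | "a - x \<le> s" "a \<le> 2*x"
    using assms by linarith
  then show ?thesis
  proof cases
    case 1
    then show ?thesis
      by (intro wdiffI[OF marks(4)[of "x-s"] marks(2)[of "r+1-(a-x-s)"]])
        (use assms in \<open>auto simp: algebra_simps\<close>)
  next
    case 2
    then show ?thesis
      by (intro wdiffI[OF marks(3)[of x] marks(2)[of "r+1-(a-2*x)"]])
        (use assms in \<open>auto simp: algebra_simps\<close>)
  next
    case 3
    then show ?thesis
      by (intro wdiffI[OF marks(4)[of "2*x-a"] marks(3)[of "s-(a-x)"]])
        (use assms in \<open>auto simp: algebra_simps\<close>)
  qed
qed

lemma wdiff_mid:
  assumes "0 \<le> t" "t \<le> s" "0 \<le> i" "i \<le> r"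
  shows "wdiff r s ((2*r+1) * (r+1+2*t) + (t - i))"
    and "wdiff r s ((2*r+1) * (r+1+2*t) + (t + r + 1 + i))"
proof -
  show "wdiff r s ((2*r+1) * (r+1+2*t) + (t - i))"
    by (rule wdiffI[OF marks(3)[of t] marks(1)[of i]]) (use assms in \<open>auto simp: algebra_simps\<close>)
  show "wdiff r s ((2*r+1) * (r+1+2*t) + (t + r + 1 + i))"
    by (rule wdiffI[OF marks(5)[of i] marks(3)[of "s-t"]]) (use assms in \<open>auto simp: algebra_simps\<close>)
qed

lemma wdiff_high:
  assumes "0 \<le> j" "j \<le> r+1"
  shows "0 \<le> i \<Longrightarrow> i \<le> r \<Longrightarrow> wdiff r s ((2*r+1) * (2*s+r+1+j) + (s + r + 1 + i))"
    and "0 \<le> i \<Longrightarrow> i \<le> r \<Longrightarrow> wdiff r s ((2*r+1) * (2*s+r+1+j) + (s + j - i))"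
    and "j \<le> i \<Longrightarrow> i \<le> r+1 \<Longrightarrow> wdiff r s ((2*r+1) * (2*s+r+1+j) + (s + i))"
proof -
  show "wdiff r s ((2*r+1) * (2*s+r+1+j) + (s + r + 1 + i))" if "0 \<le> i" "i \<le> r"
    by (rule wdiffI[OF marks(5)[of i] marks(2)[of "r+1-j"]])
      (use assms that in \<open>auto simp: algebra_simps\<close>)
  show "wdiff r s ((2*r+1) * (2*s+r+1+j) + (s + j - i))" if "0 \<le> i" "i \<le> r"
    by (rule wdiffI[OF marks(4)[of j] marks(1)[of i]])
      (use assms that in \<open>auto simp: algebra_simps\<close>)
  show "wdiff r s ((2*r+1) * (2*s+r+1+j) + (s + i))" if "j \<le> i" "i \<le> r+1"
    by (rule wdiffI[OF marks(4)[of i] marks(2)[of "i-j"]])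
      (use assms that r in \<open>auto simp: algebra_simps\<close>)
qed

lemma wdiff_row_low:
  assumes "0 \<le> a" "a \<le> r+1" "-r \<le> x" "x \<le> a + r"
  shows "wdiff r s ((2*r+1) * a + x)"
proof -
  consider "x \<le> 0" | "a \<le> x" | "0 \<le> x" "x \<le> a" by linarith
  then show ?thesis
  proof cases
    case 1 then show ?thesis using wdiff_low(1)[of a "-x"] assms by simp
  next
    case 2 then show ?thesis using wdiff_low(2)[of a "x-a"] assms by simp
  next
    case 3 then show ?thesis using wdiff_core[of x a] assms s by simp
  qed
qed

lemma wdiff_row_mid:
  assumes "0 \<le> t" "t \<le> s" "t - r \<le> x" "x \<le> t + 2*r + 1"
  shows "wdiff r s ((2*r+1) * (r+1+2*t) + x)"
proof -
  consider "x \<le> t" | "t + r + 1 \<le> x" | "t \<le> x" "x \<le> t+r+1" by linarith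
  then show ?thesis
  proof cases
    case 1 then show ?thesis using wdiff_mid(1)[of t "t-x"] assms by simp
  next
    case 2 then show ?thesis using wdiff_mid(2)[of t "x-t-r-1"] assms by simp
  next
    case 3 then show ?thesis using wdiff_core[of x "r+1+2*t"] assms r by simp
  qed
qed

lemma wdiff_row_high:
  assumes "0 \<le> j" "j \<le> r+1" "s + j - r \<le> x" "x \<le> s + 2*r + 1"
  shows "wdiff r s ((2*r+1) * (2*s+r+1+j) + x)"
proof -
  consider "x \<le> s+j" | "s + r + 1 \<le> x" | "s+j \<le> x" "x \<le> s+r+1" by linarith
  then show ?thesis
  proof cases
    case 1 then show ?thesis using wdiff_high(2)[of j "s+j-x"] assms by simp
  next
    case 2 then show ?thesis using wdiff_high(1)[of j "x-s-r-1"] assms by simp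
  next
    case 3 then show ?thesis using wdiff_high(3)[of j "x-s"] assms r by simp
  qed
qed

text \<open>Row a+1 starts at offset -r, which is offset r+1 of row a, and row a reaches at least
  offset r.\<close>

lemma wdiff_upto_low:
  "0 \<le> a \<Longrightarrow> a \<le> r+1 \<Longrightarrow> 0 \<le> d \<Longrightarrow> d \<le> (2*r+1) * a + (a + r) \<Longrightarrow> wdiff r s d"
proof (induction a arbitrary: d rule: int_ge_induct)
  case base
  then show ?case using wdiff_row_low[of 0 d] r by simp
next
  case (step a)
  show ?case
  proof (cases "d \<le> (2*r+1) * a + (a + r)")
    case True then show ?thesis using step by simp
  next
    case False
    then show ?thesis
      using wdiff_row_low[of "a+1" "d - (2*r+1) * (a+1)"] step by (simp add: algebra_simps)
  qed
qed

text \<open>A gap 4r+3 raises the row by two, so \<open>wdiff_row_mid\<close> reaches only every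
  second row. Its intervals leave exactly the offsets t+1 to t+r+1 of the row r+2+2t between them,
  and \<open>wdiff_core\<close> supplies these.\<close>

lemma wdiff_upto_mid:
  "0 \<le> t \<Longrightarrow> t \<le> s \<Longrightarrow> 0 \<le> d \<Longrightarrow> d \<le> (2*r+1) * (r+1+2*t) + (t + 2*r + 1) \<Longrightarrow> wdiff r s d"
proof (induction t arbitrary: d rule: int_ge_induct)
  case base
  then show ?case using wdiff_upto_low[of "r+1" d] r by (simp add: algebra_simps)
next
  case (step t)
  consider "d \<le> (2*r+1) * (r+1+2*t) + (t + 2*r + 1)"
    | "(2*r+1) * (r+2+2*t) + (t + 1) \<le> d" "d \<le> (2*r+1) * (r+2+2*t) + (t+r+1)"
    | "(2*r+1) * (r+2+2*t) + (t+r+1) < d"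
    by (simp add: algebra_simps) linarith
  then show ?case
  proof cases
    case 1 then show ?thesis using step by simp
  next
    case 2
    then show ?thesis
      using wdiff_core[of "d - (2*r+1) * (r+2+2*t)" "r+2+2*t"] step r by simp
  next
    case 3
    then show ?thesis
      using wdiff_row_mid[of "t+1" "d - (2*r+1) * (r+1+2*(t+1))"] step by (simp add: algebra_simps)
  qed
qed

lemma wdiff_upto_high:
  "0 \<le> j \<Longrightarrow> j \<le> r+1 \<Longrightarrow> 0 \<le> d \<Longrightarrow> d \<le> (2*r+1) * (2*s+r+1+j) + (s + 2*r + 1) \<Longrightarrow> wdiff r s d"
proof (induction j arbitrary: d rule: int_ge_induct)
  case base
  then show ?case using wdiff_upto_mid[of s d] s by (simp add: algebra_simps)
next
  case (step j)
  show ?case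
  proof (cases "d \<le> (2*r+1) * (2*s+r+1+j) + (s + 2*r + 1)")
    case True then show ?thesis using step by simp
  next
    case False
    then show ?thesis
      using wdiff_row_high[of "j+1" "d - (2*r+1) * (2*s+r+1+(j+1))"] step r
      by (simp add: algebra_simps)
  qed
qed

text \<open>The bound is the last mark of the ruler: no distance up to its length is missed.\<close>

lemma wdiff_upto:
  "0 \<le> d \<Longrightarrow> d \<le> 4*r*(r+s+2) + 3*(s+1) \<Longrightarrow> wdiff r s d"
  using wdiff_upto_high[of "r+1" d] r by (simp add: algebra_simps)

end

text \<open>A complete ruler of length l has all of -l, ..., l as differences, hence covers every
  residue modulo any n up to 2l+1: either d or n-d is at most l.\<close>

lemma wichmann_mod:
  assumes "0 \<le> r" "0 \<le> s" and n: "0 < n" "n \<le> 2 * (4*r*(r+s+2) + 3*(s+1)) + 1"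
  shows "\<exists>x\<in>wichmann r s. \<exists>y\<in>wichmann r s. n dvd (a - (x - y))"
proof -
  have w: "\<exists>x\<in>wichmann r s. \<exists>y\<in>wichmann r s. d = x - y"
    if "0 \<le> d" "d \<le> 4*r*(r+s+2) + 3*(s+1)" for d
    using wdiff_upto[OF assms(1,2) that] by (simp add: wdiff_def)
  define d where "d = a mod n"
  have d: "0 \<le> d" "d < n" using n by (auto simp: d_def)
  have da: "n dvd (a - d)" by (simp add: d_def mod_eq_dvd_iff[symmetric])
  show ?thesis
  proof (cases "d \<le> 4*r*(r+s+2) + 3*(s+1)")
    case True
    then show ?thesis using w[of d] d da by metis
  next
    case False
    then obtain x y where "x \<in> wichmann r s" "y \<in> wichmann r s" "n - d = x - y"
      using w[of "n - d"] d n by auto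
    moreover have "n dvd (a - (d - n))" using da
      by (metis add.commute add_diff_eq diff_diff_eq2 dvd_add_triv_left_iff)
    ultimately show ?thesis by (metis minus_diff_eq)
  qed
qed

text \<open>
  The value \<open>32\<close> is a genuine gap of the parameter table: \<open>7\<close> marks reach \<open>31\<close>, while \<open>8\<close> marks
  are admissible only from \<open>33\<close> on. For large \<open>n\<close> the choice \<open>s = 2r\<close> is asymptotically optimal.
\<close>

lemma wichmann_params:
  fixes n :: int
  assumes "11 \<le> n" "n \<noteq> 32"
  shows "\<exists>r s. 0 \<le> r \<and> 0 \<le> s \<and> n \<le> 2 * (4*r*(r+s+2) + 3*(s+1)) + 1 \<and>
    293 * (4*r+s+3)^2 \<le> 576 * n"
proof (cases "n < 1030")
  case True
  show ?thesis
  proof (rule ccontr)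
    assume "\<not> ?thesis"
    then have no: "576 * n < 293 * (4*r+s+3)^2"
      if "0 \<le> r" "0 \<le> s" "n \<le> 2 * (4*r*(r+s+2) + 3*(s+1)) + 1" for r s
      using that by (meson not_le)
    \<comment> \<open>Each line tries one pair (r, s). The previous lower bound on n already makes
      its number of marks admissible, so n must exceed twice its length plus one. The exclusion of
      32 enters at the pair (1, 1), and the last pair reaches 1039.\<close>
    have "13 < n" using no[of 0 1] assms by (cases "n \<le> 13") simp_all
    then have "19 < n" using no[of 0 2] assms by (cases "n \<le> 19") simp_all
    then have "25 < n" using no[of 0 3] assms by (cases "n \<le> 25") simp_all
    then have "31 < n" using no[of 1 0] assms by (cases "n \<le> 31") simp_all
    then have "45 < n" using no[of 1 1] assms by (cases "n \<le> 45") simp_all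
    then have "59 < n" using no[of 1 2] assms by (cases "n \<le> 59") simp_all
    then have "73 < n" using no[of 1 3] assms by (cases "n \<le> 73") simp_all
    then have "101 < n" using no[of 1 5] assms by (cases "n \<le> 101") simp_all
    then have "137 < n" using no[of 2 3] assms by (cases "n \<le> 137") simp_all
    then have "181 < n" using no[of 2 5] assms by (cases "n \<le> 181") simp_all
    then have "225 < n" using no[of 2 7] assms by (cases "n \<le> 225") simp_all
    then have "307 < n" using no[of 3 6] assms by (cases "n \<le> 307") simp_all
    then have "397 < n" using no[of 3 9] assms by (cases "n \<le> 397") simp_all
    then have "503 < n" using no[of 4 8] assms by (cases "n \<le> 503") simp_all
    then have "655 < n" using no[of 4 12] assms by (cases "n \<le> 655") simp_all
    then have "839 < n" using no[of 5 12] assms by (cases "n \<le> 839") simp_all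
    then show False using no[of 6 12] True by simp
  qed
next
  case False
  \<comment> \<open>With s = 2r the bound on the number of marks is 6r+3. The largest r with an
    admissible number of marks is taken; failure for r+1 bounds n from above, and this must stay
    within the reach of the ruler for r.\<close>
  let ?Q = "\<lambda>r::nat. 293 * (6 * int r + 3)^2 \<le> 576 * n"
  have b: "r \<le> nat (576 * n)" if "?Q r" for r
  proof -
    have "int r \<le> 293 * (6 * int r + 3)^2" by (simp add: power2_eq_square algebra_simps)
    then show ?thesis using that by linarith
  qed
  have "?Q 6" using False by simp
  then obtain r where r: "?Q r" and m: "\<And>k. ?Q k \<Longrightarrow> k \<le> r"
    using GreatestI_nat[of ?Q 6] Greatest_le_nat[of ?Q] b by blast
  have r6: "6 \<le> r" using m \<open>?Q 6\<close> by blast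
  have "\<not> ?Q (Suc r)" using m[of "Suc r"] by auto
  then have 1: "576 * n < 10548 * (int r * int r) + 31644 * int r + 23733"
    by (simp add: power2_eq_square algebra_simps)
  \<comment> \<open>The leading coefficient 10548/576 is below 24, and from r = 6 on this surplus
    outweighs the larger linear and constant terms.\<close>
  have "6 * int r \<le> int r * int r" using r6 by (intro mult_right_mono) auto
  then have "n \<le> 24 * (int r * int r) + 28 * int r + 7"
    using 1 r6 by linarith
  then have "n \<le> 2 * (4*int r*(int r+2*int r+2) + 3*(2*int r+1)) + 1"
    by (simp add: algebra_simps)
  then show ?thesis using r
    by (intro exI[of _ "int r"] exI[of _ "2 * int r"]) simp
qed

section \<open>Difference bases of cyclic groups\<close>

lemma difference_size_le:
  "finite B \<Longrightarrow> difference_basis G A B \<Longrightarrow> difference_size G A \<le> card B"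
  unfolding difference_size_def by (rule Least_le) blast

lemma difference_size_attained:
  assumes "group G" "finite A" "A \<subseteq> carrier G"
  obtains B where "finite B" "difference_basis G A B" "card B = difference_size G A"
proof -
  interpret group G by fact
  have "difference_basis G A (insert \<one>\<^bsub>G\<^esub> A)"
    using assms(3) by (force simp: difference_basis_def)
  then have "\<exists>n B. finite B \<and> difference_basis G A B \<and> card B = n"
    using assms(2) by blast
  from LeastI_ex[OF this] show ?thesis
    using that unfolding difference_size_def by blast
qed

lemma sqrt_card_le_difference_size:
  assumes "group G" "finite A" "A \<subseteq> carrier G"
  shows "sqrt (card A) \<le> difference_size G A"
proof -
  obtain B where B: "finite B" "difference_basis G A B" "card B = difference_size G A"
    using difference_size_attained[OF assms] by blast
  have "A \<subseteq> (\<lambda>(x, y). x \<otimes>\<^bsub>G\<^esub> inv\<^bsub>G\<^esub> y) ` (B \<times> B)"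
    using B(2) by (force simp: difference_basis_def)
  then have "card A \<le> card (B \<times> B)"
    using B(1) by (meson card_image_le card_mono finite_SigmaI finite_imageI le_trans)
  then have "real (card A) \<le> (real (card B))\<^sup>2"
    by (simp add: card_cartesian_product power2_eq_square flip: of_nat_mult)
  then show ?thesis using B(3) by (simp add: real_le_lsqrt)
qed

lemma one_le_difference_char:
  assumes "group G" "finite A" "A \<subseteq> carrier G" "A \<noteq> {}"
  shows "1 \<le> difference_char G A"
  using sqrt_card_le_difference_size[OF assms(1-3)] assms(2,4)
  by (simp add: difference_char_def le_divide_eq card_gt_0_iff)

text \<open>Arbitrary integers stand for residues, so that the same set can be a set of ruler marks,
  a basis of the cyclic group, and a set of exponents of a group element.\<close>

definition mod_basis :: "nat \<Rightarrow> int set \<Rightarrow> bool" where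
  "mod_basis n D \<longleftrightarrow> finite D \<and> (\<forall>a. \<exists>x\<in>D. \<exists>y\<in>D. int n dvd a - (x - y))"

lemma mod_basis_attained:
  assumes "0 < n"
  obtains D where "mod_basis n D"
    "real (card D) = cyclic_difference_char n * sqrt n"
proof -
  let ?C = "integer_mod_group n"
  have c: "carrier ?C = {0..<int n}" using assms by (simp add: carrier_integer_mod_group)
  obtain D where D: "finite D" "difference_basis ?C (carrier ?C) D"
      "card D = difference_size ?C (carrier ?C)"
    using difference_size_attained[of ?C "carrier ?C"] c by auto
  have "\<exists>x\<in>D. \<exists>y\<in>D. int n dvd a - (x - y)" for a
  proof -
    have "a mod int n \<in> carrier ?C" using assms by (simp add: c)
    then obtain x y where xy: "x \<in> D" "y \<in> D" "a mod int n = x \<otimes>\<^bsub>?C\<^esub> inv\<^bsub>?C\<^esub> y" "y \<in> carrier ?C"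
      using D(2) unfolding difference_basis_def by blast
    then have "a mod int n = (x - y) mod int n"
      by (simp add: mod_add_right_eq)
    then show ?thesis using xy(1,2) unfolding mod_eq_dvd_iff by blast
  qed
  then have "mod_basis n D" using D(1) by (simp add: mod_basis_def)
  moreover have "real (card D) = cyclic_difference_char n * sqrt n"
    using assms by (simp add: difference_char_def D(3) c)
  ultimately show ?thesis using that by blast
qed

lemma cyclic_difference_size_le:
  assumes "0 < n" "mod_basis n D"
  shows "difference_size (integer_mod_group n) (carrier (integer_mod_group n)) \<le> card D"
proof -
  let ?C = "integer_mod_group n" and ?B = "(\<lambda>x. x mod int n) ` D"
  have c: "carrier ?C = {0..<int n}" using assms by (simp add: carrier_integer_mod_group)
  have "\<exists>x\<in>?B. \<exists>y\<in>?B. a = x \<otimes>\<^bsub>?C\<^esub> inv\<^bsub>?C\<^esub> y" if "a \<in> carrier ?C" for a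
  proof -
    obtain x y where xy: "x \<in> D" "y \<in> D" "int n dvd a - (x - y)"
      using assms(2) unfolding mod_basis_def by blast
    have "a = (x - y) mod int n"
      using that xy(3) c by (metis atLeastLessThan_iff mod_eq_dvd_iff mod_pos_pos_trivial)
    moreover have "y mod int n \<in> carrier ?C" using assms(1) c by simp
    ultimately have "a = x mod int n \<otimes>\<^bsub>?C\<^esub> inv\<^bsub>?C\<^esub> (y mod int n)"
      by (simp add: mod_simps)
    then show ?thesis using xy by blast
  qed
  then have "difference_basis ?C (carrier ?C) ?B"
    using assms(1) c by (auto simp: difference_basis_def)
  then have "difference_size ?C (carrier ?C) \<le> card ?B"
    using assms(2) by (intro difference_size_le) (auto simp: mod_basis_def)
  also have "\<dots> \<le> card D" using assms(2) by (intro card_image_le) (simp add: mod_basis_def)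
  finally show ?thesis .
qed

lemma cyclic_difference_char_le:
  assumes "11 \<le> n" "n \<noteq> 32"
  shows "cyclic_difference_char n \<le> 24 / sqrt 293"
proof -
  obtain r s where rs: "0 \<le> r" "0 \<le> s" "int n \<le> 2 * (4*r*(r+s+2) + 3*(s+1)) + 1"
      "293 * (4*r+s+3)^2 \<le> 576 * int n"
    using wichmann_params[of "int n"] assms by auto
  define N where "N = difference_size (integer_mod_group n) (carrier (integer_mod_group n))"
  have "mod_basis n (wichmann r s)"
    unfolding mod_basis_def using wichmann_mod[of r s "int n"] rs assms
    by (simp add: finite_wichmann)
  then have "int N \<le> 4*r+s+3"
    using cyclic_difference_size_le[of n] card_wichmann_le[of r s] rs assms
    unfolding N_def by fastforce
  then have "(int N)^2 \<le> (4*r+s+3)^2" by (intro power_mono) auto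
  then have "293 * (int N)^2 \<le> 576 * int n" using rs(4) by linarith
  then have "real_of_int (293 * (int N)^2) \<le> real_of_int (576 * int n)"
    by (simp only: of_int_le_iff)
  then have "293 * (real N)^2 \<le> 24^2 * real n" by simp
  then have "sqrt (293 * (real N)^2) \<le> sqrt (24^2 * real n)" by (rule real_sqrt_le_mono)
  then have "sqrt 293 * real N \<le> 24 * sqrt n" by (simp add: real_sqrt_mult)
  then show ?thesis using assms
    by (simp add: difference_char_def carrier_integer_mod_group N_def field_simps)
qed

section \<open>Structure of finite Abelian p-groups\<close>

context comm_group
begin

section \<open>Complements of cyclic subgroups of maximal order\<close>

definition adjoin :: "'a \<Rightarrow> 'a set \<Rightarrow> 'a set" where
  "adjoin y M = {y [^] (i::int) \<otimes> k | i k. k \<in> M}"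

lemma subgroup_adjoin:
  assumes "subgroup M G" "y \<in> carrier G"
  shows "subgroup (adjoin y M) G"
proof (rule subgroupI)
  note [simp] = subgroup.mem_carrier[OF assms(1)]
  show "adjoin y M \<subseteq> carrier G" using assms(2) by (auto simp: adjoin_def)
  show "adjoin y M \<noteq> {}" using subgroup.one_closed[OF assms(1)] by (auto simp: adjoin_def)
  show "inv a \<in> adjoin y M" if a: "a \<in> adjoin y M" for a
  proof -
    obtain i k where "a = y [^] (i::int) \<otimes> k" "k \<in> M" using a by (auto simp: adjoin_def)
    then have "inv a = y [^] (- i) \<otimes> inv k" "inv k \<in> M"
      using assms by (simp_all add: inv_mult int_pow_neg subgroup.m_inv_closed)
    then show ?thesis by (auto simp: adjoin_def)
  qed
  show "a \<otimes> b \<in> adjoin y M" if a: "a \<in> adjoin y M" and b: "b \<in> adjoin y M" for a b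
  proof -
    obtain i k where "a = y [^] (i::int) \<otimes> k" "k \<in> M" using a by (auto simp: adjoin_def)
    moreover obtain j l where "b = y [^] (j::int) \<otimes> l" "l \<in> M" using b by (auto simp: adjoin_def)
    ultimately have "a \<otimes> b = y [^] (i + j) \<otimes> (k \<otimes> l)" "k \<otimes> l \<in> M"
      using assms by (simp_all add: int_pow_mult m_ac subgroup.m_closed)
    then show ?thesis by (auto simp: adjoin_def)
  qed
qed

lemma adjoin_superset:
  assumes "subgroup M G" "y \<in> carrier G"
  shows "M \<subseteq> adjoin y M" "y [^] (i::int) \<in> adjoin y M" "y \<in> adjoin y M"
proof -
  note m = subgroup.mem_carrier[OF assms(1)]
  show "M \<subseteq> adjoin y M"
  proof
    fix k assume "k \<in> M"
    then have "k = y [^] (0::int) \<otimes> k" using m by simp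
    then show "k \<in> adjoin y M" using \<open>k \<in> M\<close> unfolding adjoin_def by blast
  qed
  show *: "y [^] i \<in> adjoin y M" for i :: int
  proof -
    have "y [^] i = y [^] i \<otimes> \<one>" using assms(2) by simp
    then show ?thesis using subgroup.one_closed[OF assms(1)] unfolding adjoin_def by blast
  qed
  show "y \<in> adjoin y M" using *[of 1] assms(2) by simp
qed

lemma adjoin_subset:
  assumes "subgroup K G" "M \<subseteq> K" "y \<in> K"
  shows "adjoin y M \<subseteq> K"
  using assms by (auto simp: adjoin_def intro!: subgroup.m_closed subgroup_int_pow_closed)

lemma coprime_powers_in_subgroup:
  assumes "subgroup T G" "y \<in> carrier G" "coprime i j"
    and "y [^] (i::int) \<in> T" "y [^] (j::int) \<in> T"
  shows "y \<in> T"
proof -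
  obtain s t where st: "s * i + t * j = 1" using assms(3) by (metis bezout_int coprime_imp_gcd_eq_1)
  have "y = y [^] (i * s + j * t)" using st assms(2) by (simp add: mult.commute)
  also have "\<dots> = (y [^] i) [^] s \<otimes> (y [^] j) [^] t"
    using assms(2) by (simp add: int_pow_mult int_pow_pow)
  also have "\<dots> \<in> T"
    by (intro subgroup.m_closed subgroup_int_pow_closed assms)
  finally show ?thesis .
qed

text \<open>A subgroup M maximal among those meeting the powers of a trivially is a complement. If
  some x lay outside the product T of both, a suitable modification y of a power of x could be
  adjoined to M without creating a nontrivial power of a.\<close>

lemma cyclic_complement:
  assumes K: "subgroup K G" "finite K" and p: "prime p" and a: "a \<in> K" "ord a = p ^ m"
    and kill: "\<And>x. x \<in> K \<Longrightarrow> x [^] (int p ^ m) = \<one>"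
  obtains M where "subgroup M G" "M \<subseteq> K" "\<And>i::int. a [^] i \<in> M \<Longrightarrow> a [^] i = \<one>"
    "\<And>x. x \<in> K \<Longrightarrow> \<exists>i::int. \<exists>y\<in>M. x = a [^] i \<otimes> y"
proof -
  note Kc = subgroup.mem_carrier[OF K(1)]
  define S where "S = {M. subgroup M G \<and> M \<subseteq> K \<and> (\<forall>i::int. a [^] i \<in> M \<longrightarrow> a [^] i = \<one>)}"
  have "finite S" using K(2) by (auto simp: S_def intro: finite_subset[of _ "Pow K"])
  moreover have "{\<one>} \<in> S"
    using triv_subgroup subgroup.one_closed[OF K(1)] by (auto simp: S_def)
  ultimately obtain M where "M \<in> S" and max: "\<And>N. N \<in> S \<Longrightarrow> M \<subseteq> N \<Longrightarrow> N = M"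
    using finite_has_maximal[of S] by blast
  then have M: "subgroup M G" "M \<subseteq> K" "\<And>i::int. a [^] i \<in> M \<Longrightarrow> a [^] i = \<one>"
    by (auto simp: S_def)
  note Mc = subgroup.mem_carrier[OF M(1)]
  define T where "T = adjoin a M"
  have ac: "a \<in> carrier G" using a Kc by blast
  have T: "subgroup T G" "M \<subseteq> T" "\<And>i::int. a [^] i \<in> T" "T \<subseteq> K"
    using subgroup_adjoin[OF M(1) ac] adjoin_superset[OF M(1) ac] adjoin_subset[OF K(1) M(2) a(1)]
    by (auto simp: T_def)
  have "x \<in> T" if x: "x \<in> K" for x
  proof (rule ccontr)
    assume xT: "x \<notin> T"
    have xc: "x \<in> carrier G" using x Kc by blast
    have ex: "x [^] (int p ^ m) \<in> T" using kill x subgroup.one_closed[OF T(1)] by simp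
    \<comment> \<open>The least e yields an element x' outside T whose p-th power lies in T.\<close>
    define e where "e = (LEAST e. x [^] (int p ^ e) \<in> T)"
    have e: "x [^] (int p ^ e) \<in> T" "e \<le> m"
      using LeastI[of "\<lambda>e. x [^] (int p ^ e) \<in> T", OF ex]
        Least_le[of "\<lambda>e. x [^] (int p ^ e) \<in> T", OF ex] by (auto simp: e_def)
    have "e \<noteq> 0" using e(1) xT xc by (cases "e = 0") auto
    then obtain f where f: "e = Suc f" by (cases e) auto
    have fT: "x [^] (int p ^ f) \<notin> T"
      using not_less_Least[of f "\<lambda>e. x [^] (int p ^ e) \<in> T"] f by (simp add: e_def)
    define x' where "x' = x [^] (int p ^ f)"
    have x': "x' \<in> K" "x' \<in> carrier G" "x' \<notin> T"
      using fT x xc by (auto simp: x'_def subgroup_int_pow_closed[OF K(1)])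
    have "x' [^] int p \<in> T" using e(1) xc by (simp add: x'_def f int_pow_pow mult.commute)
    then obtain i k where ik: "x' [^] int p = a [^] (i::int) \<otimes> k" "k \<in> M"
      by (auto simp: T_def adjoin_def)
    obtain l where l: "m = Suc l" using e(2) f by (cases m) auto
    \<comment> \<open>Raising to the power p^(m-1) kills the left side of \<open>ik\<close>, so a^(i
      p^(m-1)) lies in M and is trivial. Since a has order p^m, it follows that p divides i. Here
      the maximality of the order of a is used.\<close>
    have "\<one> = (x' [^] int p) [^] (int p ^ l)"
      using kill[OF x'(1)] x'(2) by (simp add: l int_pow_pow)
    also have "\<dots> = a [^] (i * int p ^ l) \<otimes> k [^] (int p ^ l)"
      using ik ac Mc by (simp add: int_pow_distrib int_pow_pow)
    finally have "a [^] (i * int p ^ l) = inv (k [^] (int p ^ l))"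
      using ik ac Mc by (metis int_pow_closed inv_equality)
    then have "a [^] (i * int p ^ l) \<in> M"
      using subgroup_int_pow_closed[OF M(1) ik(2)] subgroup.m_inv_closed[OF M(1)] by simp
    then have "int (ord a) dvd i * int p ^ l" using M(3) ac by (simp add: int_pow_eq_id)
    then have "int p dvd i" using p by (simp add: a l prime_gt_0_nat)
    then obtain j where j: "i = int p * j" by blast
    \<comment> \<open>Dividing x' by the p-th root a^j of a^i moves the p-th power from T into
      M.\<close>
    define y where "y = x' \<otimes> a [^] (- j)"
    have y: "y \<in> K" "y \<in> carrier G"
      using x' a ac subgroup_int_pow_closed[OF K(1) a(1)] subgroup.m_closed[OF K(1)]
      by (auto simp: y_def)
    have "y [^] int p = (x' [^] int p) \<otimes> a [^] (- i)"
      using x' ac by (simp add: y_def int_pow_distrib int_pow_pow j mult.commute)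
    also have "\<dots> = k" using ik ac Mc by (simp add: int_pow_neg m_ac)
    finally have yp: "y [^] int p \<in> M" using ik by simp
    have yT: "y \<notin> T"
    proof
      assume "y \<in> T"
      then have "y \<otimes> a [^] j \<in> T" using T by (simp add: subgroup.m_closed)
      moreover have "y \<otimes> a [^] j = x'" using x' ac by (simp add: y_def int_pow_neg m_assoc)
      ultimately show False using x' by simp
    qed
    define N where "N = adjoin y M"
    have N: "subgroup N G" "M \<subseteq> N" "y \<in> N" "N \<subseteq> K"
      using subgroup_adjoin[OF M(1) y(2)] adjoin_superset[OF M(1) y(2)] adjoin_subset[OF K(1) M(2) y(1)]
      by (auto simp: N_def)
    have "N \<noteq> M" using N yT T by blast
    then have "N \<notin> S" using max N by blast
    then obtain s :: int where s: "a [^] s \<in> N" "a [^] s \<noteq> \<one>" using N by (auto simp: S_def)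
    then obtain t k' where t: "a [^] s = y [^] (t::int) \<otimes> k'" "k' \<in> M" by (auto simp: N_def adjoin_def)
    \<comment> \<open>If p divides t, then y^t and hence a^s lie in M. Otherwise y^t and y^p both
      lie in T with coprime exponents, which forces y into T.\<close>
    show False
    proof (cases "int p dvd t")
      case True
      then obtain t' where "t = int p * t'" by blast
      then have "y [^] t = (y [^] int p) [^] t'" using y by (simp add: int_pow_pow)
      then have "y [^] t \<in> M" using subgroup_int_pow_closed[OF M(1) yp] by simp
      then have "a [^] s \<in> M" using t subgroup.m_closed[OF M(1)] by simp
      then show False using M(3) s by blast
    next
      case False
      then have "coprime t (int p)"
        using p by (metis coprime_commute prime_imp_coprime prime_nat_int_transfer)
      moreover have "y [^] t \<in> T"
      proof -
        have "y [^] t = a [^] s \<otimes> inv k'" using t y ac Mc by (simp add: inv_solve_right)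
        moreover have "a [^] s \<otimes> inv k' \<in> T"
          by (meson T t(2) subgroup.m_closed subgroup.m_inv_closed subsetD)
        ultimately show ?thesis by simp
      qed
      ultimately show False
        using coprime_powers_in_subgroup[OF T(1) y(2)] yp T(2) yT by blast
    qed
  qed
  then have "\<And>x. x \<in> K \<Longrightarrow> \<exists>i::int. \<exists>y\<in>M. x = a [^] i \<otimes> y"
    unfolding T_def adjoin_def by blast
  then show ?thesis using that M by blast
qed

text \<open>Orders in a p-group are totally ordered by divisibility, so the largest order is an
  exponent of K and its element has a complement.\<close>

lemma max_order_split:
  assumes K: "subgroup K G" "finite K" and p: "prime p"
    and pK: "\<And>x. x \<in> K \<Longrightarrow> \<exists>k. ord x = p ^ k"
  obtains a m M where "a \<in> K" "ord a = p ^ m" "\<And>x. x \<in> K \<Longrightarrow> x [^] (int p ^ m) = \<one>"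
    "subgroup M G" "M \<subseteq> K" "\<And>i::int. a [^] i \<in> M \<Longrightarrow> a [^] i = \<one>"
    "\<And>x. x \<in> K \<Longrightarrow> \<exists>i::int. \<exists>y\<in>M. x = a [^] i \<otimes> y"
proof -
  note Kc = subgroup.mem_carrier[OF K(1)]
  have "finite (ord ` K)" "ord ` K \<noteq> {}" using K subgroup.one_closed[OF K(1)] by auto
  from Max_in[OF this] obtain a where a: "a \<in> K" "ord a = Max (ord ` K)" by auto
  obtain m where m: "ord a = p ^ m" using pK a by blast
  have kill: "x [^] (int p ^ m) = \<one>" if x: "x \<in> K" for x
  proof -
    obtain k where k: "ord x = p ^ k" using pK x by blast
    have "p ^ k \<le> p ^ m" using K(2) x a m k by (metis Max_ge finite_imageI imageI)
    then have "k \<le> m" using p prime_gt_1_nat power_le_imp_le_exp by blast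
    then have "int (ord x) dvd int p ^ m" by (simp add: k le_imp_power_dvd)
    then show ?thesis using x Kc int_pow_eq_id by blast
  qed
  obtain M where "subgroup M G" "M \<subseteq> K" "\<And>i::int. a [^] i \<in> M \<Longrightarrow> a [^] i = \<one>"
    "\<And>x. x \<in> K \<Longrightarrow> \<exists>i::int. \<exists>y\<in>M. x = a [^] i \<otimes> y"
    using cyclic_complement[OF K p a(1) m kill] by metis
  then show ?thesis using that a m kill by blast
qed

section \<open>Graphs of isomorphisms between subgroups, twins and frames\<close>

lemma pair_subgroup_closed:
  assumes "subgroup \<Gamma> (G \<times>\<times> G)"
  shows "(\<one>, \<one>) \<in> \<Gamma>"
    and "(u, v) \<in> \<Gamma> \<Longrightarrow> u \<in> carrier G" "(u, v) \<in> \<Gamma> \<Longrightarrow> v \<in> carrier G"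
    and "(u, v) \<in> \<Gamma> \<Longrightarrow> (u', v') \<in> \<Gamma> \<Longrightarrow> (u \<otimes> u', v \<otimes> v') \<in> \<Gamma>"
    and "(u, v) \<in> \<Gamma> \<Longrightarrow> (inv u, inv v) \<in> \<Gamma>"
    and "(u, v) \<in> \<Gamma> \<Longrightarrow> (u [^] (i::int), v [^] i) \<in> \<Gamma>"
proof -
  show 1: "(\<one>, \<one>) \<in> \<Gamma>" using subgroup.one_closed[OF assms] by simp
  show c1: "u \<in> carrier G" if "(u, v) \<in> \<Gamma>" for u v using subgroup.mem_carrier[OF assms that] by simp
  show c2: "v \<in> carrier G" if "(u, v) \<in> \<Gamma>" for u v using subgroup.mem_carrier[OF assms that] by simp
  show 2: "(u \<otimes> u', v \<otimes> v') \<in> \<Gamma>" if "(u, v) \<in> \<Gamma>" "(u', v') \<in> \<Gamma>" for u v u' v'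
    using subgroup.m_closed[OF assms that] by simp
  show 3: "(inv u, inv v) \<in> \<Gamma>" if "(u, v) \<in> \<Gamma>" for u v
    using subgroup.m_inv_closed[OF assms that] c1[OF that] c2[OF that]
    by (simp add: inv_DirProd is_group)
  show "(u [^] i, v [^] i) \<in> \<Gamma>" if uv: "(u, v) \<in> \<Gamma>"
  proof -
    have n: "(u [^] n, v [^] n) \<in> \<Gamma>" for n :: nat
    proof (induction n)
      case 0 then show ?case using 1 by simp
    next
      case (Suc n) then show ?case using 2[OF Suc uv] by simp
    qed
    show ?thesis
    proof (cases i rule: int_cases2)
      case (nonneg m) then show ?thesis using n by (simp add: int_pow_int)
    next
      case (nonpos m) then show ?thesis using 3[OF n] c1[OF uv] c2[OF uv] by (simp add: int_pow_neg_int)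
    qed
  qed
qed

text \<open>
  A \<open>twin\<close> set is the graph of an isomorphism between two subgroups \<open>L\<close> and \<open>L'\<close> of \<open>G\<close> that
  intersect trivially. Working with the graph avoids choosing the isomorphism as a function.
\<close>

definition twin :: "('a \<times> 'a) set \<Rightarrow> bool" where
  "twin \<Gamma> \<longleftrightarrow> subgroup \<Gamma> (G \<times>\<times> G) \<and>
     (\<forall>u v u' v'. (u, v) \<in> \<Gamma> \<and> (u', v') \<in> \<Gamma> \<and> u \<otimes> v' = \<one> \<longrightarrow>
        u = \<one> \<and> v = \<one> \<and> u' = \<one> \<and> v' = \<one>)"

definition square :: "'a \<Rightarrow> 'a \<Rightarrow> ('a \<times> 'a) set \<Rightarrow> 'a set" where
  "square c b \<Gamma> = {c [^] (i::int) \<otimes> u \<otimes> (b [^] (j::int) \<otimes> v') | i j u v u' v'. (u, v) \<in> \<Gamma> \<and> (u', v') \<in> \<Gamma>}"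

text \<open>
  A frame says that \<open>square c b \<Gamma>\<close> is the internal direct product of \<open>\<langle>c\<rangle>\<close>, \<open>\<langle>b\<rangle>\<close>, \<open>L\<close> and \<open>L'\<close>,
  where \<open>\<Gamma>\<close> is the graph of an isomorphism \<open>L \<rightarrow> L'\<close>, the elements \<open>c\<close> and \<open>b\<close> have order \<open>q\<close>,
  and \<open>q\<close> is an exponent of \<open>L\<close>.
\<close>

definition frame :: "int \<Rightarrow> 'a \<Rightarrow> 'a \<Rightarrow> ('a \<times> 'a) set \<Rightarrow> bool" where
  "frame q c b \<Gamma> \<longleftrightarrow> c \<in> carrier G \<and> b \<in> carrier G \<and> subgroup \<Gamma> (G \<times>\<times> G) \<and>
     c [^] q = \<one> \<and> b [^] q = \<one> \<and> (\<forall>u v. (u, v) \<in> \<Gamma> \<longrightarrow> u [^] q = \<one> \<and> v [^] q = \<one>) \<and>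
     (\<forall>(i::int) (j::int) u v u' v'. (u, v) \<in> \<Gamma> \<and> (u', v') \<in> \<Gamma> \<and>
        c [^] i \<otimes> u \<otimes> (b [^] j \<otimes> v') = \<one> \<longrightarrow>
        q dvd i \<and> q dvd j \<and> u = \<one> \<and> v = \<one> \<and> u' = \<one> \<and> v' = \<one>)"

lemma frameD:
  assumes "frame q c b \<Gamma>" "(u, v) \<in> \<Gamma>" "(u', v') \<in> \<Gamma>"
    and "c [^] (i::int) \<otimes> u \<otimes> (b [^] (j::int) \<otimes> v') = \<one>"
  shows "q dvd i \<and> q dvd j \<and> u = \<one> \<and> v = \<one> \<and> u' = \<one> \<and> v' = \<one>"
  using assms(1) unfolding frame_def using assms(2-4) by fast

text \<open>For a frame this is the graph of the isomorphism that extends L -> L' by sending c to b.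
  It turns a frame into a twin set, which the induction feeds into the next frame.\<close>

definition pairs :: "'a \<Rightarrow> 'a \<Rightarrow> ('a \<times> 'a) set \<Rightarrow> ('a \<times> 'a) set" where
  "pairs c b \<Gamma> = {(c [^] (i::int) \<otimes> u, b [^] i \<otimes> v) | i u v. (u, v) \<in> \<Gamma>}"

lemma int_pow_multiple:
  assumes "x \<in> carrier G" "x [^] (q::int) = \<one>" "q dvd i"
  shows "x [^] i = \<one>"
  using assms by (metis dvd_def int_pow_one int_pow_pow)

lemma int_pow_cong:
  assumes "x \<in> carrier G" "x [^] (q::int) = \<one>" "q dvd i - j"
  shows "x [^] i = x [^] j"
proof -
  have "x [^] i = x [^] (i - j) \<otimes> x [^] j"
    using assms(1) by (simp flip: int_pow_mult)
  then show ?thesis using int_pow_multiple[OF assms] assms(1) by simp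
qed

lemma subgroup_pairs:
  assumes \<Gamma>: "subgroup \<Gamma> (G \<times>\<times> G)" and "c \<in> carrier G" "b \<in> carrier G"
  shows "subgroup (pairs c b \<Gamma>) (G \<times>\<times> G)"
proof -
  note cl = pair_subgroup_closed[OF \<Gamma>]
  interpret GG: group "G \<times>\<times> G" by (simp add: DirProd_group is_group)
  show ?thesis
  proof (rule GG.subgroupI)
    show "pairs c b \<Gamma> \<subseteq> carrier (G \<times>\<times> G)"
      using assms(2,3) cl(2,3) by (auto simp: pairs_def)
    show "pairs c b \<Gamma> \<noteq> {}" using cl(1) by (auto simp: pairs_def)
  next
    fix x assume "x \<in> pairs c b \<Gamma>"
    then obtain i u v where x: "x = (c [^] (i::int) \<otimes> u, b [^] i \<otimes> v)" "(u, v) \<in> \<Gamma>"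
      by (auto simp: pairs_def)
    then have "inv\<^bsub>G \<times>\<times> G\<^esub> x = (c [^] (- i) \<otimes> inv u, b [^] (- i) \<otimes> inv v)"
      using assms(2,3) cl(2,3)[OF x(2)] by (simp add: inv_DirProd is_group inv_mult int_pow_neg)
    then show "inv\<^bsub>G \<times>\<times> G\<^esub> x \<in> pairs c b \<Gamma>" using cl(5)[OF x(2)] unfolding pairs_def by blast
  next
    fix x y assume "x \<in> pairs c b \<Gamma>" "y \<in> pairs c b \<Gamma>"
    then obtain i u v j u' v' where x: "x = (c [^] (i::int) \<otimes> u, b [^] i \<otimes> v)" "(u, v) \<in> \<Gamma>"
      and y: "y = (c [^] (j::int) \<otimes> u', b [^] j \<otimes> v')" "(u', v') \<in> \<Gamma>"
      by (auto simp: pairs_def)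
    then have "x \<otimes>\<^bsub>G \<times>\<times> G\<^esub> y = (c [^] (i + j) \<otimes> (u \<otimes> u'), b [^] (i + j) \<otimes> (v \<otimes> v'))"
      using assms(2,3) cl(2,3)[OF x(2)] cl(2,3)[OF y(2)] by (simp add: int_pow_mult m_ac)
    then show "x \<otimes>\<^bsub>G \<times>\<times> G\<^esub> y \<in> pairs c b \<Gamma>" using cl(4)[OF x(2) y(2)] unfolding pairs_def by blast
  qed
qed

lemma twin_pairs:
  assumes f: "frame q c b \<Gamma>"
  shows "twin (pairs c b \<Gamma>)"
proof -
  have c: "c \<in> carrier G" "b \<in> carrier G" "subgroup \<Gamma> (G \<times>\<times> G)" "c [^] q = \<one>" "b [^] q = \<one>"
    using f by (auto simp: frame_def)
  have "w = \<one> \<and> x = \<one> \<and> w' = \<one> \<and> x' = \<one>"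
    if wx: "(w, x) \<in> pairs c b \<Gamma>" "(w', x') \<in> pairs c b \<Gamma>" and 1: "w \<otimes> x' = \<one>" for w x w' x'
  proof -
    obtain i u v where w: "w = c [^] (i::int) \<otimes> u" "x = b [^] i \<otimes> v" "(u, v) \<in> \<Gamma>"
      using wx(1) by (auto simp: pairs_def)
    obtain j u' v' where w': "w' = c [^] (j::int) \<otimes> u'" "x' = b [^] j \<otimes> v'" "(u', v') \<in> \<Gamma>"
      using wx(2) by (auto simp: pairs_def)
    have "q dvd i \<and> q dvd j \<and> u = \<one> \<and> v = \<one> \<and> u' = \<one> \<and> v' = \<one>"
      by (rule frameD[OF f w(3) w'(3)]) (use 1 w w' in simp)
    then show ?thesis
      using int_pow_multiple[of c q] int_pow_multiple[of b q] c w w' by simp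
  qed
  then show ?thesis using subgroup_pairs[OF c(3,1,2)] unfolding twin_def by blast
qed

lemma subgroup_square:
  assumes \<Gamma>: "subgroup \<Gamma> (G \<times>\<times> G)" and "c \<in> carrier G" "b \<in> carrier G"
  shows "subgroup (square c b \<Gamma>) G"
proof (rule subgroupI)
  note cl = pair_subgroup_closed[OF \<Gamma>]
  show "square c b \<Gamma> \<subseteq> carrier G"
    using assms(2,3) cl(2,3) by (auto simp: square_def)
  show "square c b \<Gamma> \<noteq> {}" using cl(1) unfolding square_def by blast
  show "inv x \<in> square c b \<Gamma>" if x: "x \<in> square c b \<Gamma>" for x
  proof -
    obtain i j u v u' v' where
      x: "x = c [^] (i::int) \<otimes> u \<otimes> (b [^] (j::int) \<otimes> v')" "(u, v) \<in> \<Gamma>" "(u', v') \<in> \<Gamma>"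
      using x unfolding square_def by blast
    then have "inv x = c [^] (- i) \<otimes> inv u \<otimes> (b [^] (- j) \<otimes> inv v')"
      using assms(2,3) cl(2,3)[OF x(2)] cl(2,3)[OF x(3)] by (simp add: inv_mult int_pow_neg)
    then show ?thesis using cl(5)[OF x(2)] cl(5)[OF x(3)] unfolding square_def by blast
  qed
  show "x \<otimes> y \<in> square c b \<Gamma>" if x: "x \<in> square c b \<Gamma>" and y: "y \<in> square c b \<Gamma>" for x y
  proof -
    obtain i j u v u' v' where
      x: "x = c [^] (i::int) \<otimes> u \<otimes> (b [^] (j::int) \<otimes> v')" "(u, v) \<in> \<Gamma>" "(u', v') \<in> \<Gamma>"
      using x unfolding square_def by blast
    obtain k l w z w' z' where
      y: "y = c [^] (k::int) \<otimes> w \<otimes> (b [^] (l::int) \<otimes> z')" "(w, z) \<in> \<Gamma>" "(w', z') \<in> \<Gamma>"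
      using y unfolding square_def by blast
    have "x \<otimes> y = c [^] (i + k) \<otimes> (u \<otimes> w) \<otimes> (b [^] (j + l) \<otimes> (v' \<otimes> z'))"
      using assms(2,3) cl(2,3)[OF x(2)] cl(2,3)[OF x(3)] cl(2,3)[OF y(2)] cl(2,3)[OF y(3)]
      by (simp add: x y int_pow_mult m_ac)
    then show ?thesis using cl(4)[OF x(2) y(2)] cl(4)[OF x(3) y(3)] unfolding square_def by blast
  qed
qed

lemma frame_unique:
  assumes f: "frame q c b \<Gamma>"
    and "(u, v) \<in> \<Gamma>" "(u', v') \<in> \<Gamma>" "(w, z) \<in> \<Gamma>" "(w', z') \<in> \<Gamma>"
    and eq: "c [^] (i::int) \<otimes> u \<otimes> (b [^] (j::int) \<otimes> v') = c [^] (k::int) \<otimes> w \<otimes> (b [^] (l::int) \<otimes> z')"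
  shows "q dvd i - k \<and> q dvd j - l \<and> u = w \<and> v = z \<and> u' = w' \<and> v' = z'"
proof -
  have c: "c \<in> carrier G" "b \<in> carrier G" and \<Gamma>: "subgroup \<Gamma> (G \<times>\<times> G)"
    using f by (auto simp: frame_def)
  note cl = pair_subgroup_closed[OF \<Gamma>]
  note cc [simp] = cl(2,3)[OF assms(2)] cl(2,3)[OF assms(3)] cl(2,3)[OF assms(4)] cl(2,3)[OF assms(5)] c
  have "c [^] (i - k) \<otimes> (u \<otimes> inv w) \<otimes> (b [^] (j - l) \<otimes> (v' \<otimes> inv z'))
    = c [^] i \<otimes> u \<otimes> (b [^] j \<otimes> v') \<otimes> inv (c [^] k \<otimes> w \<otimes> (b [^] l \<otimes> z'))"
    by (simp add: int_pow_diff inv_mult m_ac)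
  also have "\<dots> = \<one>" using eq by simp
  finally have 1: "c [^] (i - k) \<otimes> (u \<otimes> inv w) \<otimes> (b [^] (j - l) \<otimes> (v' \<otimes> inv z')) = \<one>" .
  have "(u \<otimes> inv w, v \<otimes> inv z) \<in> \<Gamma>" "(u' \<otimes> inv w', v' \<otimes> inv z') \<in> \<Gamma>"
    using cl(4,5) assms by auto
  note frameD[OF f this 1]
  moreover have "x = y" if "x \<otimes> inv y = \<one>" "x \<in> carrier G" "y \<in> carrier G" for x y
    using that inv_equality[of x "inv y"] by simp
  ultimately show ?thesis by simp
qed

text \<open>The number q times the size of \<open>\<Gamma>\<close> is the order of the ring R, and
  it also bounds the size of the parabola. Hence the parabola has at most as many elements as the
  square root of the order of the square.\<close>

lemma card_square_ge:
  assumes f: "frame q c b \<Gamma>" and "finite (carrier G)" "0 < q"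
  shows "(nat q * card \<Gamma>)\<^sup>2 \<le> card (square c b \<Gamma>)"
proof -
  have \<Gamma>: "subgroup \<Gamma> (G \<times>\<times> G)" and cb: "c \<in> carrier G" "b \<in> carrier G"
    using f by (auto simp: frame_def)
  let ?A = "({0..<q} \<times> \<Gamma>) \<times> ({0..<q} \<times> \<Gamma>)"
  let ?f = "\<lambda>((i, u, v), (j, u', v')). c [^] i \<otimes> u \<otimes> (b [^] j \<otimes> v')"
  have "inj_on ?f ?A"
  proof (rule inj_onI, clarsimp)
    fix i u v j u' v' k w z l w' z'
    assume a: "c [^] i \<otimes> u \<otimes> (b [^] j \<otimes> v') = c [^] k \<otimes> w \<otimes> (b [^] l \<otimes> z')"
      "0 \<le> i" "i < q" "0 \<le> j" "j < q" "0 \<le> k" "k < q" "0 \<le> l" "l < q"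
      "(u, v) \<in> \<Gamma>" "(u', v') \<in> \<Gamma>" "(w, z) \<in> \<Gamma>" "(w', z') \<in> \<Gamma>"
    then have 1: "q dvd i - k \<and> q dvd j - l \<and> u = w \<and> v = z \<and> u' = w' \<and> v' = z'"
      using frame_unique[OF f] by blast
    have "x = y" if "q dvd x - y" "0 \<le> x" "x < q" "0 \<le> y" "y < q" for x y :: int
      using that by (simp flip: mod_eq_dvd_iff)
    then have "i = k" "j = l" using a 1 by auto
    with 1 show "i = k \<and> u = w \<and> v = z \<and> j = l \<and> u' = w' \<and> v' = z'" by simp
  qed
  moreover have "?f ` ?A \<subseteq> square c b \<Gamma>"
    unfolding square_def by (clarsimp) blast
  moreover have "finite (square c b \<Gamma>)"
    using subgroup.subset[OF subgroup_square[OF \<Gamma> cb]] assms(2) finite_subset by blast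
  ultimately have "card ?A \<le> card (square c b \<Gamma>)" by (rule card_inj_on_le)
  then show ?thesis by (simp add: card_cartesian_product power2_eq_square)
qed

text \<open>
  In additive notation, \<open>R = \<int>/q \<oplus> L\<close> with \<open>L\<cdot>L = 0\<close> is a commutative ring in which \<open>(i, u)\<close> is a
  unit iff \<open>i\<close> is a unit modulo \<open>q\<close>, and \<open>(i, u)\<^sup>2 = (i\<^sup>2, 2iu)\<close>. The set below is the graph
  \<open>{(x, x\<^sup>2)}\<close> inside \<open>R \<times> R\<close>, and \<open>(x+h)\<^sup>2 - x\<^sup>2 = 2xh + h\<^sup>2\<close> takes every value if \<open>2h\<close> is a unit.
\<close>

definition parabola :: "int \<Rightarrow> 'a \<Rightarrow> 'a \<Rightarrow> ('a \<times> 'a) set \<Rightarrow> 'a set" where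
  "parabola q c b \<Gamma> = (\<lambda>(i, u, v). c [^] i \<otimes> u \<otimes> (b [^] (i\<^sup>2) \<otimes> v [^] (2 * i))) ` ({0..<q} \<times> \<Gamma>)"

text \<open>All exponents matter only modulo q, so i may lie outside the range used in the
  definition; the solutions found below are not reduced.\<close>

lemma parabola_mem:
  assumes f: "frame q c b \<Gamma>" and "0 < q" "(u, v) \<in> \<Gamma>"
  shows "c [^] (i::int) \<otimes> u \<otimes> (b [^] (i\<^sup>2) \<otimes> v [^] (2 * i)) \<in> parabola q c b \<Gamma>"
proof -
  have c: "c \<in> carrier G" "c [^] q = \<one>" "b \<in> carrier G" "b [^] q = \<one>" and \<Gamma>: "subgroup \<Gamma> (G \<times>\<times> G)"
    and v: "v [^] q = \<one>"
    using f assms(3) by (auto simp: frame_def)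
  have d: "q dvd i - i mod q" by (simp add: minus_mod_eq_mult_div)
  have "i\<^sup>2 - (i mod q)\<^sup>2 = (i - i mod q) * (i + i mod q)"
    by (simp add: power2_eq_square algebra_simps)
  then have d2: "q dvd i\<^sup>2 - (i mod q)\<^sup>2" using d by simp
  have "2 * i - 2 * (i mod q) = 2 * (i - i mod q)" by simp
  then have d3: "q dvd 2 * i - 2 * (i mod q)" using d by (metis dvd_mult)
  have "c [^] i \<otimes> u \<otimes> (b [^] (i\<^sup>2) \<otimes> v [^] (2 * i)) =
    c [^] (i mod q) \<otimes> u \<otimes> (b [^] ((i mod q)\<^sup>2) \<otimes> v [^] (2 * (i mod q)))"
    using int_pow_cong[OF c(1,2) d] int_pow_cong[OF c(3,4) d2]
      int_pow_cong[OF pair_subgroup_closed(3)[OF \<Gamma> assms(3)] v d3] by simp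
  moreover have "(i mod q, u, v) \<in> {0..<q} \<times> \<Gamma>" using assms by simp
  ultimately show ?thesis unfolding parabola_def by (metis (no_types, lifting) case_prod_conv image_eqI)
qed

lemma parabola_difference:
  assumes f: "frame q c b \<Gamma>" and q: "0 < q" "coprime (2 * h) q"
    and uv: "(u, v) \<in> \<Gamma>" "(u', v') \<in> \<Gamma>"
  shows "\<exists>x\<in>parabola q c b \<Gamma>. \<exists>y\<in>parabola q c b \<Gamma>.
    c [^] (h::int) \<otimes> u \<otimes> (b [^] (j::int) \<otimes> v') = x \<otimes> inv y"
proof -
  have c: "c \<in> carrier G" "b \<in> carrier G" "b [^] q = \<one>" and \<Gamma>: "subgroup \<Gamma> (G \<times>\<times> G)"
    and kill: "\<And>u v. (u, v) \<in> \<Gamma> \<Longrightarrow> v [^] q = \<one>"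
    using f by (auto simp: frame_def)
  note cl = pair_subgroup_closed[OF \<Gamma>]
  obtain s t where st: "s * (2 * h) + t * q = 1"
    using q(2) by (metis bezout_int coprime_imp_gcd_eq_1)
  \<comment> \<open>In R the equation 2xh' + h'^2 = (j, u') is solved for x = (y, w), where h' = (h,
    u) and s inverts 2h modulo q. The first component gives y = s(j - h^2); the second reads 2hw +
    2(y+h)u = u', hence the exponent e. The element z is the image of w in L'.\<close>
  define y where "y = s * (j - h\<^sup>2)"
  define e where "e = - (2 * (y + h))"
  define w where "w = (u' \<otimes> u [^] e) [^] s"
  define z where "z = (v' \<otimes> v [^] e) [^] s"
  have wz: "(w, z) \<in> \<Gamma>" using cl(4,6) uv by (simp add: w_def z_def)
  note cc [simp] = cl(2,3)[OF uv(1)] cl(2,3)[OF uv(2)] cl(2,3)[OF wz] c(1,2)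
  have ve: "(u' \<otimes> u [^] e, v' \<otimes> v [^] e) \<in> \<Gamma>" using cl(4,6) uv by simp
  have "s * (2 * h) - 1 = q * (- t)" using st by (simp add: algebra_simps)
  then have "q dvd s * (2 * h) - 1" by simp
  from int_pow_cong[OF cl(3)[OF ve] kill[OF ve] this]
  have z2: "z [^] (2 * h) = v' \<otimes> v [^] e" by (simp add: z_def int_pow_pow)
  have dj: "(y + h)\<^sup>2 - (j + y\<^sup>2) = q * (- t * (j - h\<^sup>2))"
  proof -
    have "(y + h)\<^sup>2 - (j + y\<^sup>2) = (s * (2 * h) - 1) * (j - h\<^sup>2)"
      by (simp add: y_def power2_eq_square algebra_simps)
    moreover have "s * (2 * h) - 1 = - t * q" using st by simp
    ultimately show ?thesis by (simp add: mult.assoc mult.left_commute)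
  qed
  have b2: "b [^] ((y + h)\<^sup>2) = b [^] j \<otimes> b [^] (y\<^sup>2)"
    using int_pow_cong[OF c(2,3), of "(y + h)\<^sup>2" "j + y\<^sup>2"] dj by (simp add: int_pow_mult)
  have vz: "v \<in> carrier G" "z \<in> carrier G" "v' \<in> carrier G" by simp_all
  have "(v \<otimes> z) [^] (2 * (y + h)) = v [^] (- e) \<otimes> z [^] (2 * h + 2 * y)"
    using vz by (simp add: int_pow_distrib e_def add.commute)
  also have "\<dots> = v [^] (- e) \<otimes> ((v' \<otimes> v [^] e) \<otimes> z [^] (2 * y))"
    by (simp only: int_pow_mult[OF vz(2)] z2)
  also have "\<dots> = (v [^] (- e) \<otimes> v [^] e) \<otimes> (v' \<otimes> z [^] (2 * y))"
    using vz by (simp add: m_ac)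
  also have "v [^] (- e) \<otimes> v [^] e = \<one>"
    using int_pow_mult[OF vz(1), of "- e" e] by simp
  also have "\<one> \<otimes> (v' \<otimes> z [^] (2 * y)) = v' \<otimes> z [^] (2 * y)" using vz by simp
  finally have v2: "(v \<otimes> z) [^] (2 * (y + h)) = v' \<otimes> z [^] (2 * y)" .
  let ?X = "c [^] (y + h) \<otimes> (u \<otimes> w) \<otimes> (b [^] ((y + h)\<^sup>2) \<otimes> (v \<otimes> z) [^] (2 * (y + h)))"
  let ?Y = "c [^] y \<otimes> w \<otimes> (b [^] (y\<^sup>2) \<otimes> z [^] (2 * y))"
  have "?X = c [^] h \<otimes> u \<otimes> (b [^] j \<otimes> v') \<otimes> ?Y"
    unfolding b2 v2 by (simp add: int_pow_mult m_ac)
  then have "c [^] h \<otimes> u \<otimes> (b [^] j \<otimes> v') = ?X \<otimes> inv ?Y"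
    by (simp add: inv_solve_right)
  then show ?thesis
    using parabola_mem[OF f q(1) cl(4)[OF uv(1) wz], of "y + h"] parabola_mem[OF f q(1) wz, of y] by blast
qed

text \<open>This gives the two outcomes of the structure theorem one common shape, usable as
  induction hypothesis: in the cyclic case the twin set is trivial.\<close>

lemma twin_of_frame:
  assumes K: "subgroup K G"
    and "(\<exists>z\<in>K. \<forall>x\<in>K. \<exists>t::int. x = z [^] t) \<or>
      (\<exists>z\<in>K. \<exists>c\<in>K. \<exists>b\<in>K. \<exists>\<Gamma> q. \<Gamma> \<subseteq> K \<times> K \<and> frame q c b \<Gamma> \<and>
        (\<forall>x\<in>K. \<exists>t::int. \<exists>y\<in>square c b \<Gamma>. x = z [^] t \<otimes> y))"
  shows "\<exists>z\<in>K. \<exists>\<Gamma>. \<Gamma> \<subseteq> K \<times> K \<and> twin \<Gamma> \<and>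
    (\<forall>x\<in>K. \<exists>t::int. \<exists>(u, v)\<in>\<Gamma>. \<exists>(u', v')\<in>\<Gamma>. x = z [^] t \<otimes> (u \<otimes> v'))"
  using assms(2)
proof
  assume "\<exists>z\<in>K. \<forall>x\<in>K. \<exists>t::int. x = z [^] t"
  then obtain z where z: "z \<in> K" "\<forall>x\<in>K. \<exists>t::int. x = z [^] t" by blast
  have zc: "z \<in> carrier G" using subgroup.mem_carrier[OF K z(1)] .
  have "subgroup {(\<one>, \<one>)} (G \<times>\<times> G)"
    using group.triv_subgroup[OF DirProd_group[OF is_group is_group]] by simp
  then have "twin {(\<one>, \<one>)}" by (simp add: twin_def)
  moreover have "\<forall>x\<in>K. \<exists>t::int. \<exists>(u, v)\<in>{(\<one>, \<one>)}. \<exists>(u', v')\<in>{(\<one>, \<one>)}. x = z [^] t \<otimes> (u \<otimes> v')"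
    using z(2) zc by simp
  moreover have "{(\<one>, \<one>)} \<subseteq> K \<times> K" using subgroup.one_closed[OF K] by simp
  ultimately show ?thesis using z(1) by blast
next
  assume "\<exists>z\<in>K. \<exists>c\<in>K. \<exists>b\<in>K. \<exists>\<Gamma> q. \<Gamma> \<subseteq> K \<times> K \<and> frame q c b \<Gamma> \<and>
    (\<forall>x\<in>K. \<exists>t::int. \<exists>y\<in>square c b \<Gamma>. x = z [^] t \<otimes> y)"
  then obtain z c b \<Gamma> q
    where a: "z \<in> K" "c \<in> K" "b \<in> K" "\<Gamma> \<subseteq> K \<times> K" and f: "frame q c b \<Gamma>"
      and g: "\<forall>x\<in>K. \<exists>t::int. \<exists>y\<in>square c b \<Gamma>. x = z [^] t \<otimes> y" by blast
  have "pairs c b \<Gamma> \<subseteq> K \<times> K"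
    using a K by (auto simp: pairs_def intro!: subgroup.m_closed subgroup_int_pow_closed)
  moreover have "\<exists>t::int. \<exists>(u, v)\<in>pairs c b \<Gamma>. \<exists>(u', v')\<in>pairs c b \<Gamma>. x = z [^] t \<otimes> (u \<otimes> v')"
    if x: "x \<in> K" for x
  proof -
    obtain t :: int and y where y: "y \<in> square c b \<Gamma>" "x = z [^] t \<otimes> y" using g x by blast
    then obtain i j u v u' v' where
      ij: "y = c [^] (i::int) \<otimes> u \<otimes> (b [^] (j::int) \<otimes> v')" "(u, v) \<in> \<Gamma>" "(u', v') \<in> \<Gamma>"
      unfolding square_def by blast
    have "(c [^] i \<otimes> u, b [^] i \<otimes> v) \<in> pairs c b \<Gamma>" "(c [^] j \<otimes> u', b [^] j \<otimes> v') \<in> pairs c b \<Gamma>"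
      using ij unfolding pairs_def by blast+
    then show ?thesis using y(2) ij(1) by fast
  qed
  ultimately show ?thesis using a(1) twin_pairs[OF f] by blast
qed

text \<open>Two cyclic factors generated by a and b, of orders p^m and p^k with k at most m, are
  split off, and the induction hypothesis is applied to the remaining factor L. It yields a twin set
  and an element z generating the rest of L. A power of a of order p^k, twisted by z, forms a frame
  with b, and the quotient is generated by a.\<close>

lemma p_group_structure:
  assumes p: "prime p" and fin: "finite (carrier G)"
    and pG: "\<And>x. x \<in> carrier G \<Longrightarrow> \<exists>k. ord x = p ^ k"
    and K: "subgroup K G"
  shows "(\<exists>z\<in>K. \<forall>x\<in>K. \<exists>t::int. x = z [^] t) \<or>
      (\<exists>z\<in>K. \<exists>c\<in>K. \<exists>b\<in>K. \<exists>\<Gamma> k. \<Gamma> \<subseteq> K \<times> K \<and> 0 < k \<and> frame (int p ^ k) c b \<Gamma> \<and>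
        (\<forall>x\<in>K. \<exists>t::int. \<exists>y\<in>square c b \<Gamma>. x = z [^] t \<otimes> y))"
  using K
proof (induction "card K" arbitrary: K rule: less_induct)
  case less
  note K = less.prems
  note Kc = subgroup.mem_carrier[OF K]
  have finK: "finite K" using fin subgroup.subset[OF K] finite_subset by blast
  obtain a m M where a: "a \<in> K" "ord a = p ^ m" "\<And>x. x \<in> K \<Longrightarrow> x [^] (int p ^ m) = \<one>"
    and M: "subgroup M G" "M \<subseteq> K" "\<And>i::int. a [^] i \<in> M \<Longrightarrow> a [^] i = \<one>"
      "\<And>x. x \<in> K \<Longrightarrow> \<exists>i::int. \<exists>y\<in>M. x = a [^] i \<otimes> y"
    using max_order_split[OF K finK p pG[OF Kc]] by metis
  note Mc = subgroup.mem_carrier[OF M(1)]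
  have finM: "finite M" using finK M(2) finite_subset by blast
  obtain b k L where b: "b \<in> M" "ord b = p ^ k" "\<And>x. x \<in> M \<Longrightarrow> x [^] (int p ^ k) = \<one>"
    and L: "subgroup L G" "L \<subseteq> M" "\<And>i::int. b [^] i \<in> L \<Longrightarrow> b [^] i = \<one>"
      "\<And>x. x \<in> M \<Longrightarrow> \<exists>i::int. \<exists>y\<in>L. x = b [^] i \<otimes> y"
    using max_order_split[OF M(1) finM p pG[OF Mc]] by metis
  note Lc = subgroup.mem_carrier[OF L(1)]
  have ac: "a \<in> carrier G" and bc: "b \<in> carrier G" using a b Kc Mc by auto
  show ?case
  proof (cases "k = 0")
    case True
    have "x = \<one>" if "x \<in> M" for x using b(3)[OF that] Mc[OF that] True by simp
    then have "\<exists>t::int. x = a [^] t" if "x \<in> K" for x using M(4)[OF that] ac by force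
    then show ?thesis using a(1) by blast
  next
    case False
    define q where "q = int p ^ k"
    have "b \<notin> L"
    proof
      assume "b \<in> L"
      then have "b = \<one>" using L(3)[of 1] bc by simp
      then show False using b(2) False one_less_power[OF prime_gt_1_nat[OF p], of k] by simp
    qed
    then have "L \<subset> K" using L(2) M(2) b(1) by blast
    then have "card L < card K" using finK by (rule psubset_card_mono[rotated])
    from less.hyps[OF this L(1)]
    have "\<exists>z\<in>L. \<exists>\<Gamma>. \<Gamma> \<subseteq> L \<times> L \<and> twin \<Gamma> \<and>
      (\<forall>x\<in>L. \<exists>t::int. \<exists>(u, v)\<in>\<Gamma>. \<exists>(u', v')\<in>\<Gamma>. x = z [^] t \<otimes> (u \<otimes> v'))"
      by (intro twin_of_frame[OF L(1)]) blast
    then obtain z \<Gamma> where z: "z \<in> L" "\<Gamma> \<subseteq> L \<times> L" "twin \<Gamma>"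
      and gen: "\<And>x. x \<in> L \<Longrightarrow> \<exists>t::int. \<exists>(u, v)\<in>\<Gamma>. \<exists>(u', v')\<in>\<Gamma>. x = z [^] t \<otimes> (u \<otimes> v')"
      by blast
    have \<Gamma>: "subgroup \<Gamma> (G \<times>\<times> G)"
      and tw: "\<And>u v u' v'. (u, v) \<in> \<Gamma> \<Longrightarrow> (u', v') \<in> \<Gamma> \<Longrightarrow> u \<otimes> v' = \<one> \<Longrightarrow>
        u = \<one> \<and> v = \<one> \<and> u' = \<one> \<and> v' = \<one>"
      using z(3) unfolding twin_def by blast+
    note cl = pair_subgroup_closed[OF \<Gamma>]
    have zc: "z \<in> carrier G" using z Lc by blast
    have "int (p ^ k) dvd int p ^ m"
      using a(3)[of b] b M(2) bc by (auto simp: int_pow_eq_id)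
    then have "p ^ k dvd p ^ m" by (metis of_nat_dvd_iff of_nat_power)
    then have km: "k \<le> m" using p by (metis prime_gt_1_nat power_dvd_imp_le)
    define r where "r = int p ^ (m - k)"
    have rq: "r * q = int p ^ m" using km by (simp add: r_def q_def flip: power_add)
    \<comment> \<open>Twisting by \<open>z\<close> keeps the quotient cyclic: modulo the square, \<open>z\<close> becomes a power of \<open>a\<close>.\<close>
    define c where "c = a [^] r \<otimes> z"
    have zK: "z \<in> K" using z(1) L(2) M(2) by blast
    have cK: "c \<in> K" using a zK K by (simp add: c_def subgroup.m_closed subgroup_int_pow_closed)
    then have cc: "c \<in> carrier G" using Kc by blast
    have cpow: "c [^] i = a [^] (r * i) \<otimes> z [^] i" for i :: int
      using ac zc by (simp add: c_def int_pow_distrib int_pow_pow)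
    have killM: "x [^] q = \<one>" if "x \<in> M" for x using b(3)[OF that] by (simp add: q_def)
    have zq: "z [^] q = \<one>" using killM z(1) L(2) by blast
    have "c [^] q = \<one>"
      using zq a(3)[OF a(1)] by (simp add: cpow rq)
    moreover have "b [^] q = \<one>" using killM b by blast
    moreover have "u [^] q = \<one> \<and> v [^] q = \<one>" if "(u, v) \<in> \<Gamma>" for u v
      using that z(2) L(2) killM by blast
    moreover have "q dvd i \<and> q dvd j \<and> u = \<one> \<and> v = \<one> \<and> u' = \<one> \<and> v' = \<one>"
      if uv: "(u, v) \<in> \<Gamma>" "(u', v') \<in> \<Gamma>" and 1: "c [^] i \<otimes> u \<otimes> (b [^] j \<otimes> v') = \<one>"
      for i j :: int and u v u' v'
    proof -
      note cc [simp] = cl(2,3)[OF uv(1)] cl(2,3)[OF uv(2)] ac bc zc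
      have uL: "u \<in> L" "v' \<in> L" using uv z(2) by auto
      let ?y = "z [^] i \<otimes> u \<otimes> (b [^] j \<otimes> v')"
      have y: "?y \<in> M"
        using uL z(1) L(2) b(1)
        by (intro subgroup.m_closed[OF M(1)] subgroup_int_pow_closed[OF M(1)]) auto
      have "a [^] (r * i) \<otimes> ?y = \<one>" using 1 by (simp add: cpow m_assoc)
      then have "a [^] (r * i) = inv ?y" by (simp add: inv_equality)
      then have a1: "a [^] (r * i) = \<one>"
        using M(3)[of "r * i"] subgroup.m_inv_closed[OF M(1) y] by simp
      \<comment> \<open>The order of a is p^m = rq, and cancelling r leaves the divisibility by
        q.\<close>
      then have "r * q dvd r * i" using ac by (simp add: int_pow_eq_id a(2) rq)
      then have qi: "q dvd i" using p by (simp add: r_def prime_gt_0_nat)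
      have "z [^] i = \<one>" using int_pow_multiple[OF zc zq qi] .
      then have 2: "u \<otimes> (b [^] j \<otimes> v') = \<one>" using 1 a1 by (simp add: cpow)
      then have "b [^] j \<otimes> (u \<otimes> v') = \<one>" by (simp add: m_ac)
      then have "b [^] j = inv (u \<otimes> v')" by (simp add: inv_equality)
      then have b1: "b [^] j = \<one>"
        using L(3)[of j] subgroup.m_inv_closed[OF L(1)] subgroup.m_closed[OF L(1) uL] by simp
      then have "q dvd j" using bc by (simp add: int_pow_eq_id b(2) q_def)
      moreover have "u \<otimes> v' = \<one>" using 2 b1 by simp
      ultimately show ?thesis using tw[OF uv] qi by blast
    qed
    ultimately have f: "frame q c b \<Gamma>"
      using cc bc \<Gamma> unfolding frame_def by blast
    have "\<exists>t::int. \<exists>y\<in>square c b \<Gamma>. x = a [^] t \<otimes> y" if x: "x \<in> K" for x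
    proof -
      obtain i y where i: "x = a [^] (i::int) \<otimes> y" "y \<in> M" using M(4)[OF x] by blast
      obtain j w where j: "y = b [^] (j::int) \<otimes> w" "w \<in> L" using L(4)[OF i(2)] by blast
      obtain t u v u' v' where t: "(u, v) \<in> \<Gamma>" "(u', v') \<in> \<Gamma>" "w = z [^] (t::int) \<otimes> (u \<otimes> v')"
        using gen[OF j(2)] by blast
      note cc [simp] = cl(2,3)[OF t(1)] cl(2,3)[OF t(2)] ac bc zc
      \<comment> \<open>As c^t = a^(rt) z^t, the factor z^t is traded for c^t by lowering the
        exponent of a by rt.\<close>
      have "a [^] (i - r * t) \<otimes> a [^] (r * t) = a [^] i"
        by (simp flip: int_pow_mult)
      then have "x = (a [^] (i - r * t) \<otimes> a [^] (r * t)) \<otimes> (b [^] j \<otimes> (z [^] t \<otimes> (u \<otimes> v')))"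
        using i j t by simp
      also have "\<dots> = a [^] (i - r * t) \<otimes> (c [^] t \<otimes> u \<otimes> (b [^] j \<otimes> v'))"
        by (simp add: cpow m_ac)
      finally have "x = a [^] (i - r * t) \<otimes> (c [^] t \<otimes> u \<otimes> (b [^] j \<otimes> v'))" .
      moreover have "c [^] t \<otimes> u \<otimes> (b [^] j \<otimes> v') \<in> square c b \<Gamma>"
        using t unfolding square_def by blast
      ultimately show ?thesis by blast
    qed
    moreover have "b \<in> K" "\<Gamma> \<subseteq> K \<times> K" using b z(2) L(2) M(2) by auto
    ultimately show ?thesis
      using a(1) cK f False unfolding q_def by (intro disjI2) blast
  qed
qed

section \<open>Extensions with cyclic quotient, expressed by exponents modulo a subgroup\<close>

lemma cyclic_quotient_index:
  assumes p: "prime p" and fin: "finite (carrier G)"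
    and ordz: "\<exists>k. ord z = p ^ k"
    and H: "subgroup H G" and K: "subgroup K G" "H \<subseteq> K" and z: "z \<in> K"
  obtains c where "\<And>i::int. z [^] i \<in> H \<longleftrightarrow> int (p ^ c) dvd i" "p ^ c * card H \<le> card K"
proof -
  have zc: "z \<in> carrier G" using z subgroup.mem_carrier[OF K(1)] by blast
  note Hc = subgroup.mem_carrier[OF H]
  obtain k where k: "ord z = p ^ k" using ordz by blast
  have pk: "z [^] int (p ^ k) = \<one>" using zc k by (simp add: int_pow_eq_id)
  let ?P = "\<lambda>n. 0 < n \<and> z [^] int n \<in> H"
  have ex: "?P (p ^ k)"
    using pk subgroup.one_closed[OF H] p by (simp add: prime_gt_0_nat)
  define m where "m = (LEAST n. ?P n)"
  have m: "0 < m" "z [^] int m \<in> H" using LeastI[of ?P, OF ex] by (auto simp: m_def)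
  have iff: "z [^] i \<in> H \<longleftrightarrow> int m dvd i" for i :: int
  proof
    assume "int m dvd i"
    then obtain j where "i = int m * j" by blast
    then have "z [^] i = (z [^] int m) [^] j" using zc by (simp add: int_pow_pow)
    then show "z [^] i \<in> H" using subgroup_int_pow_closed[OF H m(2)] by simp
  next
    assume i: "z [^] i \<in> H"
    have "i mod int m = i - int m * (i div int m)" by (simp add: minus_mult_div_eq_mod)
    then have "z [^] (i mod int m) = z [^] i \<otimes> inv ((z [^] int m) [^] (i div int m))"
      using zc by (simp only: int_pow_diff int_pow_pow)
    also have "\<dots> \<in> H"
      using i m(2)
      by (simp add: subgroup.m_closed[OF H] subgroup.m_inv_closed[OF H] subgroup_int_pow_closed[OF H])
    finally have "z [^] int (nat (i mod int m)) \<in> H" using m(1) by simp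
    moreover have "nat (i mod int m) < m" using m(1) by (simp add: nat_less_iff)
    ultimately have "nat (i mod int m) = 0"
      using not_less_Least[of "nat (i mod int m)" ?P] by (auto simp: m_def)
    then have "i mod int m \<le> 0" by simp
    moreover have "0 \<le> i mod int m" using m(1) by simp
    ultimately show "int m dvd i" by (simp add: dvd_eq_mod_eq_0)
  qed
  \<comment> \<open>The order m of z modulo H divides the order of z, hence is a power of p. Below,
    the cosets z^i H with 0 <= i < m are seen to be disjoint, which bounds m times the order of
    H.\<close>
  have "m dvd p ^ k" using iff[of "int (p ^ k)"] ex by (metis of_nat_dvd_iff)
  then obtain c where c: "m = p ^ c" using p divides_primepow_nat by blast
  let ?f = "\<lambda>(i, h). z [^] (i::int) \<otimes> h"
  have "inj_on ?f ({0..<int m} \<times> H)"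
  proof (rule inj_onI, clarify)
    fix i h j h' assume ij: "i \<in> {0..<int m}" "j \<in> {0..<int m}" and h: "h \<in> H" "h' \<in> H"
      and eq: "z [^] i \<otimes> h = z [^] j \<otimes> h'"
    have hc: "h \<in> carrier G" "h' \<in> carrier G" using h Hc by auto
    have "z [^] i = z [^] j \<otimes> h' \<otimes> inv h" using eq zc hc by (metis int_pow_closed inv_solve_right m_closed)
    then have "z [^] (i - j) = h' \<otimes> inv h"
      using zc hc by (simp add: int_pow_diff m_ac)
    then have "z [^] (i - j) \<in> H" using h H by (simp add: subgroup.m_closed subgroup.m_inv_closed)
    then have "i = j" using ij iff by (simp flip: mod_eq_dvd_iff)
    then show "i = j \<and> h = h'" using eq zc hc by simp
  qed
  moreover have "?f ` ({0..<int m} \<times> H) \<subseteq> K"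
    using z K by (auto intro!: subgroup.m_closed subgroup_int_pow_closed)
  moreover have "finite K" using fin subgroup.subset[OF K(1)] finite_subset by blast
  ultimately have "card ({0..<int m} \<times> H) \<le> card K" by (rule card_inj_on_le)
  then show ?thesis using that[of c] iff by (simp add: c card_cartesian_product nat_power_eq)
qed

text \<open>Submultiplicativity: lifts z^d of a basis of the quotient are multiplied by a basis of
  H. The exponent t agrees with a difference d - d' up to a multiple of n, and that error is
  absorbed into H before the basis of H is applied.\<close>

lemma cyclic_quotient_basis:
  assumes H: "subgroup H G" and z: "z \<in> carrier G" and n: "\<And>i::int. int n dvd i \<Longrightarrow> z [^] i \<in> H"
    and gen: "\<And>x. x \<in> K \<Longrightarrow> \<exists>t::int. \<exists>y\<in>H. x = z [^] t \<otimes> y"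
    and D: "mod_basis n D" and B: "finite B" "difference_basis G H B"
  shows "\<exists>B'. finite B' \<and> difference_basis G K B' \<and> card B' \<le> card D * card B"
proof -
  let ?B' = "(\<lambda>(d, b). z [^] (d::int) \<otimes> b) ` (D \<times> B)"
  have finD: "finite D" using D by (simp add: mod_basis_def)
  have Bc: "B \<subseteq> carrier G" using B(2) by (simp add: difference_basis_def)
  have "\<exists>v\<in>?B'. \<exists>w\<in>?B'. x = v \<otimes> inv w" if x: "x \<in> K" for x
  proof -
    obtain t y where t: "x = z [^] (t::int) \<otimes> y" "y \<in> H" using gen[OF x] by blast
    obtain d d' where d: "d \<in> D" "d' \<in> D" "int n dvd t - (d - d')"
      using D unfolding mod_basis_def by blast
    have "z [^] (t - (d - d')) \<otimes> y \<in> H" using n[OF d(3)] t(2) H by (simp add: subgroup.m_closed)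
    then obtain b b' where b: "b \<in> B" "b' \<in> B" "z [^] (t - (d - d')) \<otimes> y = b \<otimes> inv b'"
      using B(2) unfolding difference_basis_def by blast
    have bc: "b \<in> carrier G" "b' \<in> carrier G" "y \<in> carrier G"
      using b Bc t(2) subgroup.mem_carrier[OF H] by auto
    have "t = (d - d') + (t - (d - d'))" by simp
    then have "x = z [^] (d - d') \<otimes> (z [^] (t - (d - d')) \<otimes> y)"
      using t(1) z bc by (metis int_pow_closed int_pow_mult m_assoc)
    also have "\<dots> = (z [^] d \<otimes> b) \<otimes> inv (z [^] d' \<otimes> b')"
      unfolding b(3) using z bc by (simp add: int_pow_diff inv_mult m_ac)
    finally have "x = (z [^] d \<otimes> b) \<otimes> inv (z [^] d' \<otimes> b')" .
    moreover have "z [^] d \<otimes> b \<in> ?B'" "z [^] d' \<otimes> b' \<in> ?B'" using b d by force+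
    ultimately show ?thesis by blast
  qed
  then have "difference_basis G K ?B'"
    using z Bc by (auto simp: difference_basis_def)
  moreover have "card ?B' \<le> card D * card B"
    using card_image_le[of "D \<times> B"] finD B(1) by (simp add: card_cartesian_product)
  ultimately show ?thesis using finD B(1) by (intro exI[of _ ?B']) simp
qed

section \<open>Difference bases of finite Abelian p-groups\<close>

text \<open>Replacing c by c^p selects the elements whose exponent of c is a non-unit modulo q. For
  the other elements twice the exponent is a unit because p is odd, so the parabola covers them, and
  only the smaller subgroup needs a further basis. As c lies outside it, its index is at least
  p.\<close>

lemma square_cover:
  assumes p: "prime p" "odd p" and fin: "finite (carrier G)"
    and ordc: "\<exists>e. ord c = p ^ e"
    and f: "frame (int p ^ k) c b \<Gamma>" and k: "0 < k"
  shows "p * card (square (c [^] int p) b \<Gamma>) \<le> card (square c b \<Gamma>)"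
    and "finite B \<Longrightarrow> difference_basis G (square (c [^] int p) b \<Gamma>) B \<Longrightarrow>
      \<exists>B'. finite B' \<and> difference_basis G (square c b \<Gamma>) B' \<and>
        real (card B') \<le> sqrt (card (square c b \<Gamma>)) + card B"
proof -
  define q where "q = int p ^ k"
  define H where "H = square c b \<Gamma>"
  define N where "N = square (c [^] int p) b \<Gamma>"
  have f: "frame q c b \<Gamma>" using f by (simp add: q_def)
  have cb: "c \<in> carrier G" "b \<in> carrier G" and \<Gamma>: "subgroup \<Gamma> (G \<times>\<times> G)"
    using f by (auto simp: frame_def)
  note cl = pair_subgroup_closed[OF \<Gamma>]
  have q: "0 < q" "int p dvd q" using p(1) k by (auto simp: q_def prime_gt_0_nat dvd_power)
  have H: "subgroup H G" using subgroup_square[OF \<Gamma> cb] by (simp add: H_def)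
  have N: "subgroup N G" using subgroup_square[OF \<Gamma> _ cb(2)] cb by (simp add: N_def)
  have NI: "c [^] (int p * i) \<otimes> u \<otimes> (b [^] (j::int) \<otimes> v') \<in> N"
    if "(u, v) \<in> \<Gamma>" "(u', v') \<in> \<Gamma>" for i j u v u' v'
  proof -
    have "c [^] (int p * i) = (c [^] int p) [^] i" using cb by (simp add: int_pow_pow)
    then show ?thesis using that unfolding N_def square_def by force
  qed
  have ND: "\<exists>i j u v u' v'. (u, v) \<in> \<Gamma> \<and> (u', v') \<in> \<Gamma> \<and>
      x = c [^] (int p * i) \<otimes> u \<otimes> (b [^] (j::int) \<otimes> v')" if "x \<in> N" for x
  proof -
    obtain i j u v u' v' where "(u, v) \<in> \<Gamma>" "(u', v') \<in> \<Gamma>"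
      "x = (c [^] int p) [^] (i::int) \<otimes> u \<otimes> (b [^] (j::int) \<otimes> v')"
      using \<open>x \<in> N\<close> unfolding N_def square_def by blast
    then show ?thesis unfolding int_pow_pow[OF cb(1)] by blast
  qed
  have NH: "N \<subseteq> H"
  proof
    fix x assume "x \<in> N"
    from ND[OF this] show "x \<in> H" unfolding H_def square_def by blast
  qed
  have "c = c [^] (1::int) \<otimes> \<one> \<otimes> (b [^] (0::int) \<otimes> \<one>)" using cb by simp
  then have cH: "c \<in> H" using cl(1) unfolding H_def square_def by blast
  have cN: "c \<notin> N"
  proof
    assume "c \<in> N"
    then obtain i j u v u' v' where uv: "(u, v) \<in> \<Gamma>" "(u', v') \<in> \<Gamma>"
      and "c = c [^] (int p * i) \<otimes> u \<otimes> (b [^] (j::int) \<otimes> v')"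
      using ND by blast
    then have "c [^] (1::int) \<otimes> \<one> \<otimes> (b [^] (0::int) \<otimes> \<one>) = c [^] (int p * i) \<otimes> u \<otimes> (b [^] j \<otimes> v')"
      using cb by simp
    from frame_unique[OF f cl(1) cl(1) uv this] have "q dvd 1 - int p * i" by blast
    then have "int p dvd 1 - int p * i" using q(2) dvd_trans by blast
    then have "int p dvd (1 - int p * i) + int p * i" by (intro dvd_add) auto
    then show False using p(1) by (simp add: prime_nat_iff)
  qed
  obtain e where e: "\<And>i::int. c [^] i \<in> N \<longleftrightarrow> int (p ^ e) dvd i" "p ^ e * card N \<le> card H"
    using cyclic_quotient_index[OF p(1) fin ordc N H NH cH] by blast
  have "e \<noteq> 0" using e(1)[of 1] cN cb by (cases "e = 0") auto
  then have "p ^ 1 \<le> p ^ e" using prime_ge_1_nat[OF p(1)] by (intro power_increasing) auto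
  then have "p * card N \<le> p ^ e * card N" by (intro mult_right_mono) auto
  then show "p * card (square (c [^] int p) b \<Gamma>) \<le> card (square c b \<Gamma>)"
    using e(2) unfolding N_def H_def by (rule le_trans)
  show "\<exists>B'. finite B' \<and> difference_basis G (square c b \<Gamma>) B' \<and>
        real (card B') \<le> sqrt (card (square c b \<Gamma>)) + card B"
    if B: "finite B" "difference_basis G (square (c [^] int p) b \<Gamma>) B"
  proof -
    define P where "P = parabola q c b \<Gamma>"
    have "\<Gamma> \<subseteq> carrier G \<times> carrier G" using cl(2,3) by auto
    then have fin\<Gamma>: "finite \<Gamma>" using fin finite_subset by blast
    have finP: "finite P" using fin\<Gamma> by (simp add: P_def parabola_def)
    have PG: "P \<subseteq> carrier G" using cb cl(2,3) by (auto simp: P_def parabola_def)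
    have "card P \<le> nat q * card \<Gamma>"
      unfolding P_def parabola_def using card_image_le[of "{0..<q} \<times> \<Gamma>"] fin\<Gamma>
      by (simp add: card_cartesian_product)
    then have "(card P)\<^sup>2 \<le> card H"
      using card_square_ge[OF f fin q(1)] by (metis H_def le_trans power_mono zero_le)
    then have "real ((card P)\<^sup>2) \<le> real (card H)" by (simp only: of_nat_le_iff)
    then have cP: "real (card P) \<le> sqrt (card H)" by (intro real_le_rsqrt) simp
    have "\<exists>y\<in>P \<union> B. \<exists>y'\<in>P \<union> B. x = y \<otimes> inv y'" if xH: "x \<in> H" for x
    proof -
      obtain i j u v u' v' where
        x: "x = c [^] (i::int) \<otimes> u \<otimes> (b [^] (j::int) \<otimes> v')" "(u, v) \<in> \<Gamma>" "(u', v') \<in> \<Gamma>"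
        using xH unfolding H_def square_def by blast
      show ?thesis
      proof (cases "int p dvd i")
        case True
        then obtain i' where "i = int p * i'" by blast
        then have "x \<in> N" using NI x by blast
        then show ?thesis using B(2) unfolding N_def difference_basis_def by blast
      next
        case False
        have "prime (int p)" using p(1) by simp
        moreover have "\<not> int p dvd 2"
        proof
          assume "int p dvd 2"
          then have "p dvd 2" by presburger
          then show False using p by (metis primes_dvd_imp_eq two_is_prime_nat dvd_refl)
        qed
        ultimately have "coprime (int p) (2 * i)"
          using False by (intro prime_imp_coprime) (auto simp: prime_dvd_mult_iff)
        then have "coprime (2 * i) q" by (simp add: q_def coprime_commute)
        from parabola_difference[OF f q(1) this x(2,3)] show ?thesis
          unfolding x(1) P_def by blast
      qed
    qed
    then have "difference_basis G H (P \<union> B)"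
      using PG B(2) by (auto simp: difference_basis_def)
    moreover have "real (card (P \<union> B)) \<le> sqrt (card H) + card B"
      using card_Un_le[of P B] cP by linarith
    ultimately show ?thesis using finP B(1) unfolding H_def by blast
  qed
qed

text \<open>The assumption on F makes the recursion close: a basis of the smaller subgroup N costs
  at most S F sqrt(|H|/p), the parabola adds sqrt(|H|), and the sum is at most F sqrt(|H|). The
  cyclic quotient K/H then costs a factor S. Since N need not come with a frame, the induction runs
  over all subgroups and splits N afresh.\<close>

lemma p_group_difference_basis:
  fixes S F :: real
  assumes p: "prime p" "odd p" and fin: "finite (carrier G)"
    and pG: "\<And>x. x \<in> carrier G \<Longrightarrow> \<exists>k. ord x = p ^ k"
    and D: "\<And>c. \<exists>D. mod_basis (p ^ c) D \<and> real (card D) \<le> S * sqrt (p ^ c)"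
    and S: "0 \<le> S" and F: "1 \<le> F" "1 + S * F / sqrt p \<le> F"
    and K: "subgroup K G"
  shows "\<exists>B. finite B \<and> difference_basis G K B \<and> real (card B) \<le> S * F * sqrt (card K)"
  using K
proof (induction "card K" arbitrary: K rule: less_induct)
  case less
  note K = less.prems
  note Kc = subgroup.mem_carrier[OF K]
  have finK: "finite K" using fin subgroup.subset[OF K] finite_subset by blast
  have extend: ?case
    if H: "subgroup H G" "H \<subseteq> K" and z: "z \<in> K"
      and gen: "\<And>x. x \<in> K \<Longrightarrow> \<exists>t::int. \<exists>y\<in>H. x = z [^] t \<otimes> y"
      and B: "finite B" "difference_basis G H B" "real (card B) \<le> F * sqrt (card H)" for H z B
  proof -
    have zc: "z \<in> carrier G" using z Kc by blast
    obtain c where c: "\<And>i::int. z [^] i \<in> H \<longleftrightarrow> int (p ^ c) dvd i" "p ^ c * card H \<le> card K"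
      using cyclic_quotient_index[OF p(1) fin pG[OF zc] H(1) K H(2) z] by blast
    obtain D where D: "mod_basis (p ^ c) D" "real (card D) \<le> S * sqrt (p ^ c)" using D by blast
    obtain B' where B': "finite B'" "difference_basis G K B'" "card B' \<le> card D * card B"
      using cyclic_quotient_basis[OF H(1) zc _ gen D(1) B(1,2)] c(1) by blast
    have "real (card B') \<le> real (card D) * real (card B)"
      using B'(3) by (metis of_nat_le_iff of_nat_mult)
    also have "\<dots> \<le> (S * sqrt (p ^ c)) * (F * sqrt (card H))"
      using D(2) B(3) S by (intro mult_mono) auto
    also have "\<dots> = S * F * sqrt (real (p ^ c * card H))"
      by (simp add: real_sqrt_mult)
    also have "\<dots> \<le> S * F * sqrt (card K)"
      using c(2) S F(1) by (intro mult_left_mono real_sqrt_le_mono) (simp_all only: of_nat_le_iff, simp)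
    finally show ?thesis using B' by blast
  qed
  consider z where "z \<in> K" "\<forall>x\<in>K. \<exists>t::int. x = z [^] t"
    | z c b \<Gamma> k where "z \<in> K" "c \<in> K" "b \<in> K" "\<Gamma> \<subseteq> K \<times> K" "0 < k" "frame (int p ^ k) c b \<Gamma>"
      "\<forall>x\<in>K. \<exists>t::int. \<exists>y\<in>square c b \<Gamma>. x = z [^] t \<otimes> y"
    using p_group_structure[OF p(1) fin pG K] by blast
  then show ?case
  proof cases
    case (1 z)
    have zc: "z \<in> carrier G" using 1 Kc by blast
    \<comment> \<open>For cyclic K the trivial subgroup takes the place of H; its one-element basis
      satisfies the bound because F is at least 1.\<close>
    have "difference_basis G {\<one>} {\<one>}" by (simp add: difference_basis_def)
    moreover have "\<exists>t::int. \<exists>y\<in>{\<one>}. x = z [^] t \<otimes> y" if "x \<in> K" for x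
      using 1(2) that zc by simp
    moreover have "{\<one>} \<subseteq> K" using subgroup.one_closed[OF K] by simp
    ultimately show ?thesis
      using extend[OF triv_subgroup _ 1(1), of "{\<one>}"] F(1) by simp
  next
    case (2 z c b \<Gamma> k)
    let ?H = "square c b \<Gamma>" and ?N = "square (c [^] int p) b \<Gamma>"
    have cb: "c \<in> carrier G" "b \<in> carrier G" using 2 Kc by auto
    have \<Gamma>: "subgroup \<Gamma> (G \<times>\<times> G)" using 2 by (simp add: frame_def)
    have H: "subgroup ?H G" and N: "subgroup ?N G"
      using subgroup_square[OF \<Gamma> cb] subgroup_square[OF \<Gamma> _ cb(2), of "c [^] int p"] cb by auto
    have HK: "?H \<subseteq> K"
      unfolding square_def using 2(2-4) K
      by (auto intro!: subgroup.m_closed subgroup_int_pow_closed)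
    note sq = square_cover[OF p fin pG[OF cb(1)] 2(6,5)]
    have "finite ?N" using fin subgroup.subset[OF N] finite_subset by blast
    then have N0: "0 < card ?N" using subgroup.one_closed[OF N] by (auto simp: card_gt_0_iff)
    have "1 * card ?N < p * card ?N"
      using N0 prime_gt_1_nat[OF p(1)] by (intro mult_strict_right_mono) auto
    also have "\<dots> \<le> card ?H" by (rule sq(1))
    also have "\<dots> \<le> card K" using HK finK by (rule card_mono[rotated])
    finally obtain B where B: "finite B" "difference_basis G ?N B"
        "real (card B) \<le> S * F * sqrt (card ?N)"
      using less.hyps[OF _ N] by auto
    obtain B' where B': "finite B'" "difference_basis G ?H B'"
        "real (card B') \<le> sqrt (card ?H) + card B"
      using sq(2)[OF B(1,2)] by blast
    have p0: "0 < real p" using prime_gt_0_nat[OF p(1)] by simp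
    have "real (p * card ?N) \<le> real (card ?H)" using sq(1) by (simp only: of_nat_le_iff)
    then have "sqrt (card ?N) \<le> sqrt (card ?H / p)"
      using p0 by (intro real_sqrt_le_mono) (simp add: field_simps)
    then have "S * F * sqrt (card ?N) \<le> S * F * sqrt (card ?H / p)"
      using S F(1) by (intro mult_left_mono) auto
    then have "real (card B') \<le> sqrt (card ?H) + S * F * (sqrt (card ?H) / sqrt p)"
      using B(3) B'(3) by (simp add: real_sqrt_divide)
    also have "\<dots> = (1 + S * F / sqrt p) * sqrt (card ?H)" by (simp add: algebra_simps)
    also have "\<dots> \<le> F * sqrt (card ?H)" using F(2) by (intro mult_right_mono) auto
    finally have "real (card B') \<le> F * sqrt (card ?H)" .
    then show ?thesis using extend[OF H HK 2(1) _ B'(1,2)] 2(7) by blast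
  qed
qed

end

theorem theorem6p3:
  fixes p :: nat and G :: "('a, 'b) monoid_scheme"
  assumes "prime p" and "p \<ge> 11"
    and "comm_group G" and "finite (carrier G)" and "p_group p G"
  shows "ereal (difference_char G (carrier G))
           \<le> ereal ((sqrt p - 1) / (sqrt p - 3)) *
               (SUP k\<in>{1::nat..}. ereal (cyclic_difference_char (p ^ k)))
       \<and> ereal ((sqrt p - 1) / (sqrt p - 3)) *
               (SUP k\<in>{1::nat..}. ereal (cyclic_difference_char (p ^ k)))
           \<le> ereal ((sqrt p - 1) / (sqrt p - 3) * (24 / sqrt 293))"
proof -
  interpret comm_group G by fact
  define F where "F = (sqrt p - 1) / (sqrt p - 3)"
  define S where "S = (SUP k\<in>{1::nat..}. cyclic_difference_char (p ^ k))"
  have oddp: "odd p" using assms(1,2) prime_odd_nat by auto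
  have p0: "0 < p" using assms(2) by simp
  have "sqrt (3\<^sup>2) < sqrt p" using assms(2) by (intro real_sqrt_less_mono) simp
  then have sp: "3 < sqrt p" by simp
  have F0: "0 \<le> F" "1 \<le> F" using sp p0 by (auto simp: F_def field_simps)
  have up: "cyclic_difference_char (p ^ k) \<le> 24 / sqrt 293" if "1 \<le> k" for k
  proof (rule cyclic_difference_char_le)
    have "p ^ 1 \<le> p ^ k" using that p0 by (intro power_increasing) auto
    then show "11 \<le> p ^ k" using assms(2) by simp
    have "odd (p ^ k)" using oddp by simp
    then show "p ^ k \<noteq> 32" by (metis even_numeral)
  qed
  have bdd: "bdd_above ((\<lambda>k. cyclic_difference_char (p ^ k)) ` {1::nat..})"
    using up by (intro bdd_aboveI2) auto
  have le_S: "cyclic_difference_char (p ^ k) \<le> S" if "1 \<le> k" for k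
    unfolding S_def using that bdd by (intro cSUP_upper) auto
  have S_le: "S \<le> 24 / sqrt 293"
    unfolding S_def using up by (intro cSUP_least) auto
  have S1: "1 \<le> S"
  proof -
    have "1 \<le> cyclic_difference_char p"
      using p0 by (intro one_le_difference_char) (auto simp: carrier_integer_mod_group)
    then show ?thesis using le_S[of 1] by simp
  qed
  \<comment> \<open>The extended supremum is finite, being bounded above and at least one real
    member, so it agrees with the real one.\<close>
  have SUP_eq: "(SUP k\<in>{1::nat..}. ereal (cyclic_difference_char (p ^ k))) = ereal S"
  proof -
    let ?X = "SUP k\<in>{1::nat..}. ereal (cyclic_difference_char (p ^ k))"
    have "?X \<le> ereal (24 / sqrt 293)" using up by (intro SUP_least) auto
    moreover have "ereal (cyclic_difference_char (p ^ 1)) \<le> ?X" by (intro SUP_upper) simp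
    ultimately have "\<bar>?X\<bar> \<noteq> \<infinity>" by auto
    then show ?thesis unfolding S_def by (rule ereal_SUP[symmetric])
  qed
  have "12 \<le> sqrt 293" by (rule real_le_rsqrt) simp
  then have "24 / sqrt 293 \<le> 2" by (simp add: field_simps)
  then have S2: "S \<le> 2" using S_le by linarith
  have D: "\<exists>D. mod_basis (p ^ c) D \<and> real (card D) \<le> S * sqrt (p ^ c)" for c
  \<comment> \<open>The exponent 0 occurs when the quotient is trivial. It is outside the range of
    the supremum, so the bound for the one-element basis comes from 1 <= S.\<close>
  proof (cases "c = 0")
    case True
    have "mod_basis 1 {0}" by (simp add: mod_basis_def)
    then show ?thesis using True S1 by (intro exI[of _ "{0}"]) simp
  next
    case False
    obtain D where D: "mod_basis (p ^ c) D"
        "real (card D) = cyclic_difference_char (p ^ c) * sqrt (p ^ c)"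
      using mod_basis_attained[of "p ^ c"] p0 by auto
    have "cyclic_difference_char (p ^ c) * sqrt (p ^ c) \<le> S * sqrt (p ^ c)"
      using le_S[of c] False by (intro mult_right_mono) auto
    then show ?thesis using D by auto
  qed
  \<comment> \<open>F is chosen so that F - 1 = 2/(sqrt p - 3). With S <= 2 and sqrt p - 1 <= sqrt
    p, the term S F / sqrt p is at most this value.\<close>
  have "S * (sqrt p - 1) \<le> 2 * (sqrt p - 1)" using S2 sp by (intro mult_right_mono) linarith+
  also have "\<dots> \<le> 2 * sqrt p" by simp
  finally have "S * (sqrt p - 1) / (sqrt p * (sqrt p - 3)) \<le> 2 * sqrt p / (sqrt p * (sqrt p - 3))"
    using sp by (intro divide_right_mono) auto
  also have "\<dots> = 2 / (sqrt p - 3)" using p0 by simp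
  also have "\<dots> = F - 1" using sp by (simp add: F_def field_simps)
  finally have F2: "1 + S * F / sqrt p \<le> F" by (simp add: F_def mult.commute)
  obtain B where B: "finite B" "difference_basis G (carrier G) B"
      "real (card B) \<le> S * F * sqrt (card (carrier G))"
    using p_group_difference_basis[OF assms(1) oddp assms(4) _ D _ F0(2) F2 subgroup_self]
      assms(5) S1 by (auto simp: p_group_def)
  have "0 < card (carrier G)" using assms(4) by (auto simp: card_gt_0_iff)
  then have "difference_char G (carrier G) \<le> F * S"
    using B(3) difference_size_le[OF B(1,2)]
    by (simp add: difference_char_def divide_le_eq mult.commute)
  moreover have "F * S \<le> F * (24 / sqrt 293)" using S_le F0(1) by (rule mult_left_mono)
  ultimately show ?thesis unfolding SUP_eq F_def by simp
qed

end
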